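(* Let $c > 0$ be a constant. There exists a constant $K = K(c) > 0$ such that for every $n$ and every cross-intersecting pair of families $\mathcal{A}, \mathcal{B} \subset S_n$ with $\sqrt{|\mathcal{A}||\mathcal{B}|} \geq c(n-1)!$, there exist $i, j \in [n]$ such that \[|\{\sigma \in \mathcal{A} : \sigma(i) \neq j\}| \leq K(n-2)! \quad\text{and}\quad |\{\sigma \in \mathcal{B} : \sigma(i) \neq j\}| \leq K(n-2)!,\] i.e. all but at most $O((n-2)!)$ permutations in $\mathcal{A}$ and all but at most $O((n-2)!)$ permutations in $\mathcal{B}$ map $i$ to $j$.
   Context: $S_n$ is the symmetric group on $[n]=\{1,\ldots,n\}$. A pair of families $\mathcal{A},\mathcal{B} \subset S_n$ is cross-intersecting if for every $\sigma \in \mathcal{A}$ and every $\tau \in \mathcal{B}$ there is some $i \in [n]$ with $\sigma(i) = \tau(i)$. The $O(\cdot)$ is as $n\to\infty$ with $c$ fixed. *)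

theory Defs
  imports "HOL-Combinatorics.Permutations" Complex_Main
begin

definition sym_grp :: "nat \<Rightarrow> (nat \<Rightarrow> nat) set" where
  "sym_grp n = {\<sigma>. \<sigma> permutes {1..n}}"

definition cross_intersecting :: "nat \<Rightarrow> (nat \<Rightarrow> nat) set \<Rightarrow> (nat \<Rightarrow> nat) set \<Rightarrow> bool" where
  "cross_intersecting n A B \<longleftrightarrow> (\<forall>\<sigma>\<in>A. \<forall>\<tau>\<in>B. \<exists>i\<in>{1..n}. \<sigma> i = \<tau> i)"

end

theory Submission
  imports Defs "HOL-Analysis.Convex"
begin

text \<open>
  Write \<open>X\<close> for the number of agreements of two permutations. The polynomial
  \<open>w(X) = 1 - X + (X choose 2) - (X choose 3)\<close> is nonpositive for \<open>X \<ge> 1\<close> and has mean \<open>1/3\<close>, so for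
  cross-intersecting \<open>A\<close>, \<open>B\<close> the quantity \<open>|A| |B| / 3\<close> is bounded by the three bilinear forms with
  kernel \<open>(X choose k)\<close>, \<open>k = 1, 2, 3\<close>, evaluated at the centred indicators. These forms are positive
  semidefinite, and a large sieve argument bounds them by \<open>o((n-1)!)\<close> times the squared norm
  unless the form for \<open>k = 1\<close> (the energy, which records the densities of a family on the stars
  \<open>{\<sigma>. \<sigma> i = j}\<close>) is of the maximal order \<open>(n-1)!\<close>. Hence \<open>|A| |B| = O((n-1)!\<^sup>2)\<close> in general,
  and under the hypothesis of the theorem both families have large energy. A fourth moment bound for
  \<open>\<sigma> \<mapsto> \<Sum>i. y i (\<sigma> i)\<close> then forces the smaller family \<open>B\<close> to have positive density in some star
  \<open>i \<mapsto> j\<close>. Finally, for \<open>k \<noteq> j\<close> the parts of \<open>A\<close> with \<open>\<sigma> i = k\<close> and of \<open>B\<close> with \<open>\<sigma> i = j\<close> become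
  cross-intersecting in the symmetric group on \<open>n - 1\<close> points, so the general bound makes the first
  part \<open>O((n-3)!)\<close>; summing over \<open>k\<close>, and then exchanging the roles of \<open>A\<close> and \<open>B\<close>, gives the result.
\<close>

section \<open>Estimates for factorials and binomial coefficients\<close>

lemma pow_fact_le:
  assumes "2 * (a + b) \<le> n"
  shows "n ^ b * fact (n - a - b) \<le> 2 ^ b * (fact (n - a) :: nat)"
  using assms
proof (induction b)
  case (Suc b)
  have e: "n - a - b = Suc (n - a - Suc b)" using Suc.prems by simp
  \<comment> \<open>The induction peels off one factor of the descending product (n-a)!/(n-a-b)!;
    each such factor is at least n/2.\<close>
  have "n \<le> 2 * (n - a - b)" using Suc.prems by simp
  then have "n ^ Suc b * fact (n - a - Suc b) \<le> n ^ b * (2 * (n - a - b)) * fact (n - a - Suc b)"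
    by simp
  also have "\<dots> = 2 * (n ^ b * fact (n - a - b))"
  proof -
    have "fact (n - a - b) = (n - a - b) * (fact (n - a - Suc b) :: nat)"
      using e by (metis fact_Suc of_nat_id)
    then show ?thesis by simp
  qed
  also have "\<dots> \<le> 2 * (2 ^ b * fact (n - a))" using Suc by simp
  finally show ?case by simp
qed simp

text \<open>This bounds one summand of \<open>cyl_kernel_eq\<close>. Estimating the binomial
  coefficient by n^(k-q) and each of the q top factors of the factorial by n leaves n^k (n-2k)!,
  whatever q is, and \<open>pow_fact_le\<close> with a = b = k turns that into 2^k (n-k)!.\<close>

lemma choose_mult_fact_le:
  assumes n: "4 * k \<le> n" and q: "q \<le> k" and m: "m \<le> n"
  shows "real (m choose (k - q)) * fact (n - 2 * k + q) \<le> 2 ^ k * fact (n - k)"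
proof -
  have a: "m choose (k - q) \<le> n ^ (k - q)"
  proof (cases "k - q \<le> m")
    case True
    then have "m choose (k - q) \<le> m ^ (k - q)" by (rule binomial_le_pow)
    also have "\<dots> \<le> n ^ (k - q)" using m by (rule power_mono) simp
    finally show ?thesis .
  qed (simp add: binomial_eq_0)
  have b: "fact (n - 2 * k + q) \<le> n ^ q * (fact (n - 2 * k) :: nat)"
    using q
  proof (induction q)
    case (Suc q)
    have "fact (n - 2 * k + Suc q) = (n - 2 * k + Suc q) * (fact (n - 2 * k + q) :: nat)"
      by (metis add_Suc_right fact_Suc of_nat_id)
    also have "\<dots> \<le> n * (n ^ q * fact (n - 2 * k))"
      using Suc n by (intro mult_le_mono) auto
    finally show ?case by simp
  qed simp
  have "(m choose (k - q)) * fact (n - 2 * k + q) \<le> n ^ (k - q) * (n ^ q * fact (n - 2 * k))"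
    using a b by (rule mult_le_mono)
  also have "\<dots> = n ^ k * fact (n - k - k)"
    using q by (simp add: power_add[symmetric] mult.assoc[symmetric] mult_2)
  also have "\<dots> \<le> 2 ^ k * fact (n - k)"
    using n by (intro pow_fact_le) simp
  finally have "real ((m choose (k - q)) * fact (n - 2 * k + q)) \<le> real (2 ^ k * fact (n - k))"
    by (rule of_nat_mono)
  then show ?thesis by simp
qed

lemma square_sum_le_card:
  fixes a :: "'b \<Rightarrow> real"
  shows "(\<Sum>x\<in>I. a x)\<^sup>2 \<le> card I * (\<Sum>x\<in>I. (a x)\<^sup>2)"
  using Cauchy_Schwarz_ineq_sum[of "\<lambda>_. 1" a I] by simp

lemma fact_diff_two_le:
  assumes "2 \<le> n"
  shows "fact (n - 2) \<le> 2 * fact (n - 1) / real n"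
proof -
  have e: "fact (n - 1) = real (n - 1) * fact (n - 2)"
    using assms fact_reduce[of "n - 1", where 'a = real] by (simp add: numeral_2_eq_2)
  have "real n * fact (n - 2) \<le> 2 * real (n - 1) * fact (n - 2)"
    using assms by (intro mult_right_mono) auto
  then have "real n * fact (n - 2) \<le> 2 * fact (n - 1)" by (simp only: e mult.assoc)
  then show ?thesis using assms by (simp add: pos_le_divide_eq mult.commute)
qed

text \<open>The left side is the size of the two-coincidence remainder in the sieve; the point is
  the gain of a factor 1/n over the scale (n-1)!^3.\<close>

lemma fact_diff_two_square_le:
  assumes "2 \<le> n"
  shows "(fact (n - 2))\<^sup>2 * fact n \<le> 4 * fact (n - 1) ^ 3 / real n"
proof -
  have "fact n = real n * fact (n - 1)" using assms by (intro fact_reduce) simp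
  then have "(fact (n - 2))\<^sup>2 * fact n \<le> (2 * fact (n - 1) / real n)\<^sup>2 * (real n * fact (n - 1))"
    using fact_diff_two_le[OF assms] by (simp only:) (intro mult_right_mono power_mono, auto)
  also have "\<dots> = 4 * fact (n - 1) ^ 3 / real n"
    using assms by (simp add: power2_eq_square power3_eq_cube)
  finally show ?thesis .
qed

lemma fact_mult_choose_le:
  assumes "m \<le> n"
  shows "fact (n - m) * real (n choose m) \<le> fact n"
proof -
  have "fact m * fact (n - m) * (n choose m) = (fact n :: nat)"
    using binomial_fact_lemma[OF assms] .
  then have "fact (n - m) * (n choose m) \<le> (fact n :: nat)"
    by (metis fact_ge_1 mult.assoc mult_le_mono1 mult_1)
  then have "real (fact (n - m) * (n choose m)) \<le> real (fact n)" by (rule of_nat_mono)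
  then show ?thesis by simp
qed

section \<open>Numerical constants and the polynomial inequality\<close>

definition sieve_const :: "nat \<Rightarrow> real" where
  "sieve_const k = 8 * 16 ^ k * (2 * real k + 1)\<^sup>2 * real k ^ 8"

text \<open>Odd truncation of inclusion-exclusion: 1 - x + (x choose 2) - (x choose 3) equals
  -((x-1) choose 3), which is at most 0 once x \<ge> 1.\<close>

lemma one_add_choose_two_le: "1 \<le> x \<Longrightarrow> 1 + (x choose 2) \<le> x + (x choose 3)"
  by (cases x) (auto simp: numeral_2_eq_2 numeral_3_eq_3)

lemma sieve_const_mono: "j \<le> k \<Longrightarrow> sieve_const j \<le> sieve_const k"
  unfolding sieve_const_def by (intro mult_mono power_mono power_increasing) auto

lemma sieve_const_ge_1: "1 \<le> sieve_const 3"
  by (simp add: sieve_const_def)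

text \<open>The first summand comes from \<open>energy_cind_le\<close>; the 1 pays for the extra
  summand of \<open>total_energy\<close>.\<close>

definition energy_const :: real where
  "energy_const = 2 * sieve_const 3 + 1"

text \<open>One of three forms carries a third of |A| |B| / 3. The sixth power of this 1/9 gives
  9^6, and the square comes from using the sieve bound once for each family.\<close>

definition cross_const :: real where
  "cross_const = 9 ^ 6 * (sieve_const 3)\<^sup>2"

lemma energy_const_ge_1: "1 \<le> energy_const"
  using sieve_const_ge_1 by (simp add: energy_const_def)

lemma cross_const_ge_1: "1 \<le> cross_const"
  using one_le_power[OF sieve_const_ge_1, of 2] by (simp add: cross_const_def)

text \<open>The constant in the general bound |A| |B| \<le> \<open>card_const\<close> (n-1)!^2 of
  \<open>cross_card_le\<close>.\<close>

definition card_const :: real where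
  "card_const = cross_const * energy_const\<^sup>2"

lemma card_const_ge_1: "1 \<le> card_const"
  unfolding card_const_def
  using mult_mono[OF cross_const_ge_1 one_le_power[OF energy_const_ge_1, of 2]] cross_const_ge_1 by simp

text \<open>The guaranteed energy of B relative to (n-1)! |B| when |A| |B| \<ge> c (n-1)!^2. The 2
  reserves half of the total energy for its summand of order 1/n.\<close>

definition energy_ratio :: "real \<Rightarrow> real" where
  "energy_ratio c = c ^ 3 / (2 * cross_const * energy_const)"

text \<open>Chosen so that, as \<delta>, it keeps the main term 144 C \<delta>^2 of the fourth
  moment bound below 144/400 of \<open>energy_ratio c ^ 4\<close>, where C is
  \<open>sieve_const 3\<close>.\<close>

definition star_density :: "real \<Rightarrow> real" where
  "star_density c = (energy_ratio c)\<^sup>2 / (20 * sieve_const 3)"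

lemma energy_ratio_pos: "0 < c \<Longrightarrow> 0 < energy_ratio c"
  using cross_const_ge_1 energy_const_ge_1 by (simp add: energy_ratio_def)

lemma star_density_pos: "0 < c \<Longrightarrow> 0 < star_density c"
  using energy_ratio_pos[of c] sieve_const_ge_1 by (simp add: star_density_def)

section \<open>Permutations of a finite ground set and counts of extensions\<close>

locale finite_ground =
  fixes D :: "'a set"
  assumes finite_D [simp]: "finite D"
begin

definition perms :: "('a \<Rightarrow> 'a) set" where
  "perms = {\<sigma>. \<sigma> permutes D}"

definition agree :: "('a \<Rightarrow> 'a) \<Rightarrow> ('a \<Rightarrow> 'a) \<Rightarrow> 'a set" where
  "agree \<sigma> \<tau> = {i \<in> D. \<sigma> i = \<tau> i}"

definition subsets :: "nat \<Rightarrow> 'a set set" where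
  "subsets k = {S. S \<subseteq> D \<and> card S = k}"

lemma finite_perms [simp]: "finite perms"
  unfolding perms_def by (rule finite_permutations) simp

lemma card_perms: "card perms = fact (card D)"
  unfolding perms_def by (rule card_permutations) simp_all

lemma finite_agree [simp]: "finite (agree \<sigma> \<tau>)"
  by (simp add: agree_def)

lemma finite_subsets [simp]: "finite (subsets k)"
  by (simp add: subsets_def)

lemma card_subsets: "card (subsets k) = card D choose k"
  by (simp add: subsets_def n_subsets)

lemma subsetsD: "S \<in> subsets k \<Longrightarrow> S \<subseteq> D" "S \<in> subsets k \<Longrightarrow> card S = k"
  "S \<in> subsets k \<Longrightarrow> finite S"
  by (auto simp: subsets_def intro: finite_subset)

lemma perms_in_D: "\<sigma> \<in> perms \<Longrightarrow> i \<in> D \<Longrightarrow> \<sigma> i \<in> D"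
  by (simp add: perms_def permutes_in_image)

lemma perms_eq_iff: "\<sigma> \<in> perms \<Longrightarrow> \<sigma> i = \<sigma> j \<longleftrightarrow> i = j"
  by (simp add: perms_def permutes_inj inj_eq)

lemma perms_inj_on: "\<sigma> \<in> perms \<Longrightarrow> inj_on \<sigma> S"
  by (simp add: perms_def permutes_inj_on)

lemma perms_surj: "\<sigma> \<in> perms \<Longrightarrow> j \<in> D \<Longrightarrow> \<exists>i\<in>D. \<sigma> i = j"
  by (metis (mono_tags) imageE mem_Collect_eq perms_def permutes_image)

text \<open>Fix one extension \<tau> of the partial injection; the extensions are exactly the
  compositions of \<tau> with permutations of \<open>D - S\<close>.\<close>

lemma card_perms_extending:
  assumes S: "S \<subseteq> D" and inj: "inj_on p S" and im: "p ` S \<subseteq> D"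
  shows "card {\<rho> \<in> perms. \<forall>i\<in>S. \<rho> i = p i} = fact (card D - card S)"
proof -
  have fS: "finite S" using S by (rule finite_subset) simp
  have "card (D - S) = card (D - p ` S)"
    using S im fS inj by (simp add: card_Diff_subset card_image)
  then obtain h where h: "bij_betw h (D - S) (D - p ` S)"
    using finite_same_card_bij[of "D - S" "D - p ` S"] by auto
  define \<tau> where "\<tau> = (\<lambda>i. if i \<in> S then p i else if i \<in> D then h i else i)"
  have b1: "bij_betw \<tau> S (p ` S)"
    using inj by (auto simp: bij_betw_def \<tau>_def inj_on_def)
  have "bij_betw \<tau> (D - S) (D - p ` S) \<longleftrightarrow> bij_betw h (D - S) (D - p ` S)"
    by (rule bij_betw_cong) (auto simp: \<tau>_def)
  then have b2: "bij_betw \<tau> (D - S) (D - p ` S)" using h by blast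
  have "bij_betw \<tau> (S \<union> (D - S)) (p ` S \<union> (D - p ` S))"
    by (rule bij_betw_combine[OF b1 b2]) auto
  then have "bij_betw \<tau> D D" using S im by (simp add: Un_absorb1 Un_Diff_cancel)
  then have \<tau>: "\<tau> permutes D"
    by (rule bij_imp_permutes) (use S in \<open>auto simp: \<tau>_def\<close>)
  have "bij_betw (\<lambda>\<rho>. \<tau> \<circ> \<rho>) {\<rho>. \<rho> permutes (D - S)} {\<rho> \<in> perms. \<forall>i\<in>S. \<rho> i = p i}"
  proof (rule bij_betw_byWitness[where f' = "\<lambda>\<rho>. inv \<tau> \<circ> \<rho>"])
    show "\<forall>\<rho>\<in>{\<rho>. \<rho> permutes D - S}. inv \<tau> \<circ> (\<tau> \<circ> \<rho>) = \<rho>"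
      using \<tau> by (simp add: o_assoc permutes_inv_o)
    show "\<forall>\<rho>\<in>{\<rho> \<in> perms. \<forall>i\<in>S. \<rho> i = p i}. \<tau> \<circ> (inv \<tau> \<circ> \<rho>) = \<rho>"
      using \<tau> by (simp add: o_assoc permutes_inv_o)
    show "(\<lambda>\<rho>. \<tau> \<circ> \<rho>) ` {\<rho>. \<rho> permutes D - S} \<subseteq> {\<rho> \<in> perms. \<forall>i\<in>S. \<rho> i = p i}"
    proof clarify
      fix \<rho> assume r: "\<rho> permutes D - S"
      then have "\<rho> permutes D" by (rule permutes_subset) auto
      then have "\<tau> \<circ> \<rho> \<in> perms" using \<tau> by (simp add: perms_def permutes_compose)
      moreover have "\<forall>i\<in>S. (\<tau> \<circ> \<rho>) i = p i"
        using permutes_not_in[OF r] by (simp add: \<tau>_def)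
      ultimately show "\<tau> \<circ> \<rho> \<in> perms \<and> (\<forall>i\<in>S. (\<tau> \<circ> \<rho>) i = p i)" by blast
    qed
    show "(\<lambda>\<rho>. inv \<tau> \<circ> \<rho>) ` {\<rho> \<in> perms. \<forall>i\<in>S. \<rho> i = p i} \<subseteq> {\<rho>. \<rho> permutes D - S}"
    proof clarify
      fix \<rho> assume r: "\<rho> \<in> perms" "\<forall>i\<in>S. \<rho> i = p i"
      have perm: "inv \<tau> \<circ> \<rho> permutes D"
        using r \<tau> by (simp add: perms_def permutes_compose permutes_inv)
      show "inv \<tau> \<circ> \<rho> permutes D - S"
      proof (rule permutes_superset[OF perm])
        fix i assume "i \<in> D - (D - S)"
        then have "i \<in> S" using S by auto
        then have "\<rho> i = \<tau> i" using r by (simp add: \<tau>_def)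
        then show "(inv \<tau> \<circ> \<rho>) i = i" using \<tau> by (simp add: permutes_inverses)
      qed
    qed
  qed
  then have "card {\<rho> \<in> perms. \<forall>i\<in>S. \<rho> i = p i} = card {\<rho>. \<rho> permutes (D - S)}"
    by (rule bij_betw_same_card[symmetric])
  also have "\<dots> = fact (card D - card S)"
    using S fS by (simp add: card_permutations card_Diff_subset)
  finally show ?thesis .
qed

lemma card_perms_agree:
  assumes "\<tau> \<in> perms" "S \<subseteq> D"
  shows "card {\<rho> \<in> perms. \<forall>i\<in>S. \<rho> i = \<tau> i} = fact (card D - card S)"
  using assms perms_in_D by (intro card_perms_extending) (auto simp: perms_inj_on)

lemma card_perms_point:
  assumes "i \<in> D" "j \<in> D"
  shows "card {\<rho> \<in> perms. \<rho> i = j} = fact (card D - 1)"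
  using card_perms_extending[of "{i}" "\<lambda>_. j"] assms by simp

lemma card_perms_two_points:
  assumes "i \<in> D" "j \<in> D" "k \<in> D" "l \<in> D" "i \<noteq> k" "j \<noteq> l"
  shows "card {\<rho> \<in> perms. \<rho> i = j \<and> \<rho> k = l} = fact (card D - 2)"
  using card_perms_extending[of "{i, k}" "\<lambda>x. if x = i then j else l"] assms
  by (simp add: numeral_2_eq_2)

lemma sum_perms_point:
  fixes h :: "'a \<Rightarrow> real"
  assumes "i \<in> D"
  shows "(\<Sum>\<sigma>\<in>perms. h (\<sigma> i)) = fact (card D - 1) * (\<Sum>j\<in>D. h j)"
proof -
  have "(\<Sum>\<sigma>\<in>perms. h (\<sigma> i)) = (\<Sum>j\<in>D. \<Sum>\<sigma>\<in>{\<sigma> \<in> perms. \<sigma> i = j}. h (\<sigma> i))"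
    by (rule sum.group[symmetric]) (use assms perms_in_D in auto)
  also have "\<dots> = (\<Sum>j\<in>D. fact (card D - 1) * h j)"
  proof (rule sum.cong)
    fix j assume j: "j \<in> D"
    have "(\<Sum>\<sigma>\<in>{\<sigma> \<in> perms. \<sigma> i = j}. h (\<sigma> i)) = (\<Sum>\<sigma>\<in>{\<sigma> \<in> perms. \<sigma> i = j}. h j)"
      by (rule sum.cong) auto
    then show "(\<Sum>\<sigma>\<in>{\<sigma> \<in> perms. \<sigma> i = j}. h (\<sigma> i)) = fact (card D - 1) * h j"
      using card_perms_point[OF assms j] by simp
  qed simp
  finally show ?thesis by (simp add: sum_distrib_left)
qed

text \<open>The images of i and k are distinct, so only pairs j \<noteq> l occur, each for (n-2)!
  permutations with n = \<open>card D\<close>. Adding the nonnegative diagonal terms lets the double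
  sum factor.\<close>

lemma sum_perms_two_points_le:
  fixes h :: "'a \<Rightarrow> real" and h' :: "'a \<Rightarrow> real"
  assumes ik: "i \<in> D" "k \<in> D" "i \<noteq> k" and nn: "\<And>x. h x \<ge> 0" "\<And>x. h' x \<ge> 0"
  shows "(\<Sum>\<sigma>\<in>perms. h (\<sigma> i) * h' (\<sigma> k)) \<le> fact (card D - 2) * ((\<Sum>j\<in>D. h j) * (\<Sum>l\<in>D. h' l))"
proof -
  have "(\<Sum>\<sigma>\<in>perms. h (\<sigma> i) * h' (\<sigma> k))
      = (\<Sum>x\<in>D \<times> D. \<Sum>\<sigma>\<in>{\<sigma> \<in> perms. (\<sigma> i, \<sigma> k) = x}. h (\<sigma> i) * h' (\<sigma> k))"
    by (rule sum.group[symmetric]) (use ik perms_in_D in auto)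
  also have "\<dots> \<le> (\<Sum>x\<in>D \<times> D. fact (card D - 2) * (h (fst x) * h' (snd x)))"
  proof (rule sum_mono)
    fix x assume "x \<in> D \<times> D"
    then obtain j l where x: "x = (j, l)" "j \<in> D" "l \<in> D" by auto
    have "(\<Sum>\<sigma>\<in>{\<sigma> \<in> perms. (\<sigma> i, \<sigma> k) = x}. h (\<sigma> i) * h' (\<sigma> k))
        = (\<Sum>\<sigma>\<in>{\<sigma> \<in> perms. \<sigma> i = j \<and> \<sigma> k = l}. h j * h' l)"
      by (rule sum.cong) (auto simp: x)
    also have "\<dots> = card {\<sigma> \<in> perms. \<sigma> i = j \<and> \<sigma> k = l} * (h j * h' l)" by simp
    also have "\<dots> \<le> fact (card D - 2) * (h j * h' l)"
    proof (rule mult_right_mono)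
      show "real (card {\<sigma> \<in> perms. \<sigma> i = j \<and> \<sigma> k = l}) \<le> fact (card D - 2)"
      proof (cases "j = l")
        case True
        then have "{\<sigma> \<in> perms. \<sigma> i = j \<and> \<sigma> k = l} = {}" using ik perms_eq_iff by fastforce
        then show ?thesis by (simp only: card.empty) simp
      next
        case False
        then show ?thesis using card_perms_two_points ik x by simp
      qed
    qed (simp add: nn)
    finally show "(\<Sum>\<sigma>\<in>{\<sigma> \<in> perms. (\<sigma> i, \<sigma> k) = x}. h (\<sigma> i) * h' (\<sigma> k))
        \<le> fact (card D - 2) * (h (fst x) * h' (snd x))" by (simp add: x)
  qed
  also have "\<dots> = fact (card D - 2) * ((\<Sum>j\<in>D. h j) * (\<Sum>l\<in>D. h' l))"
    by (subst sum_distrib_left[symmetric]) (simp only: sum_product sum.cartesian_product case_prod_unfold)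
  finally show ?thesis .
qed

section \<open>Cylinders and the agreement kernel summed over a cylinder\<close>

definition cyl :: "'a set \<Rightarrow> ('a \<Rightarrow> 'a) \<Rightarrow> ('a \<Rightarrow> 'a) set" where
  "cyl S \<sigma> = {\<rho> \<in> perms. \<forall>i\<in>S. \<rho> i = \<sigma> i}"

text \<open>\<open>overlap\<close> sees values shared by \<tau> and \<sigma> at any two positions of
  S, \<open>coinc\<close> only those at the same position. The kernel below depends on \<sigma> and
  \<tau> only through the two cardinalities.\<close>

definition overlap :: "'a set \<Rightarrow> ('a \<Rightarrow> 'a) \<Rightarrow> ('a \<Rightarrow> 'a) \<Rightarrow> 'a set" where
  "overlap S \<sigma> \<tau> = {i \<in> S. \<tau> i \<in> \<sigma> ` S}"

definition coinc :: "'a set \<Rightarrow> ('a \<Rightarrow> 'a) \<Rightarrow> ('a \<Rightarrow> 'a) \<Rightarrow> 'a set" where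
  "coinc S \<sigma> \<tau> = {i \<in> S. \<sigma> i = \<tau> i}"

text \<open>The kernel of a composition of operators: first the agreement kernel of order k, then
  summation over the coset \<open>cyl S \<sigma>\<close>.\<close>

definition cyl_kernel :: "nat \<Rightarrow> 'a set \<Rightarrow> ('a \<Rightarrow> 'a) \<Rightarrow> ('a \<Rightarrow> 'a) \<Rightarrow> real" where
  "cyl_kernel k S \<sigma> \<tau> = (\<Sum>\<rho>\<in>cyl S \<sigma>. real (card (agree \<rho> \<tau>) choose k))"

lemma finite_cyl [simp]: "finite (cyl S \<sigma>)"
  by (simp add: cyl_def)

lemma cyl_subset: "cyl S \<sigma> \<subseteq> perms"
  by (auto simp: cyl_def)

lemma card_cyl: "\<sigma> \<in> perms \<Longrightarrow> S \<in> subsets k \<Longrightarrow> card (cyl S \<sigma>) = fact (card D - k)"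
  using card_perms_agree[of \<sigma> S] subsetsD[of S k] by (simp add: cyl_def)

text \<open>A k-subset of the agreement set is a k-set of positions on which the two permutations
  coincide. This turns the binomial kernel into a sum of coset indicators.\<close>

lemma agree_choose_eq_sum:
  "real (card (agree \<sigma> \<tau>) choose k) = (\<Sum>S\<in>subsets k. if \<forall>i\<in>S. \<sigma> i = \<tau> i then 1 else 0)"
proof -
  have "(\<Sum>S\<in>subsets k. if \<forall>i\<in>S. \<sigma> i = \<tau> i then 1 else 0 :: real)
      = real (card {S \<in> subsets k. \<forall>i\<in>S. \<sigma> i = \<tau> i})"
    by (simp add: sum.If_cases Int_def)
  also have "{S \<in> subsets k. \<forall>i\<in>S. \<sigma> i = \<tau> i} = {S. S \<subseteq> agree \<sigma> \<tau> \<and> card S = k}"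
    by (auto simp: subsets_def agree_def)
  finally show ?thesis by (simp add: n_subsets)
qed

lemma card_overlap_eq_sum:
  assumes "\<sigma> \<in> perms" "finite S"
  shows "real (card (overlap S \<sigma> \<tau>)) = (\<Sum>i\<in>S. \<Sum>i'\<in>S. if \<tau> i = \<sigma> i' then 1 else 0)"
proof -
  have "(\<Sum>i'\<in>S. if \<tau> i = \<sigma> i' then 1 else 0 :: real) = (if \<tau> i \<in> \<sigma> ` S then 1 else 0)" for i
  proof (cases "\<tau> i \<in> \<sigma> ` S")
    case True
    then obtain j where j: "j \<in> S" "\<tau> i = \<sigma> j" by auto
    then have "(\<Sum>i'\<in>S. if \<tau> i = \<sigma> i' then 1 else 0 :: real) = (\<Sum>i'\<in>S. if j = i' then 1 else 0)"
      using assms perms_eq_iff by (intro sum.cong) auto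
    then show ?thesis using True j assms by simp
  next
    case False
    then show ?thesis by (auto intro!: sum.neutral)
  qed
  then show ?thesis using assms(2) by (simp add: overlap_def sum.If_cases Int_def)
qed

lemma card_coinc_eq_sum:
  "finite S \<Longrightarrow> real (card (coinc S \<sigma> \<tau>)) = (\<Sum>i\<in>S. if \<tau> i = \<sigma> i then 1 else 0)"
  by (auto simp: coinc_def sum.If_cases Int_def intro!: arg_cong[where f = card])

lemma coinc_subset_overlap: "coinc S \<sigma> \<tau> \<subseteq> overlap S \<sigma> \<tau>"
  by (auto simp: coinc_def overlap_def intro: rev_image_eqI)

text \<open>Let W be the set of positions where \<tau> takes a value of \<sigma> on S. Both S and W
  have k elements and they meet exactly in the overlap, so the complement of their union is counted
  by inclusion-exclusion.\<close>

lemma card_free_positions: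
  assumes \<sigma>: "\<sigma> \<in> perms" and \<tau>: "\<tau> \<in> perms" and S: "S \<in> subsets k" and n: "2 * k \<le> card D"
  shows "card {i \<in> D - S. \<tau> i \<notin> \<sigma> ` S} = card D - 2 * k + card (overlap S \<sigma> \<tau>)"
proof -
  note SD = subsetsD[OF S]
  define W where "W = {i \<in> D. \<tau> i \<in> \<sigma> ` S}"
  have "\<tau> ` W = \<sigma> ` S"
  proof
    show "\<sigma> ` S \<subseteq> \<tau> ` W"
    proof clarify
      fix i assume i: "i \<in> S"
      then obtain j where "j \<in> D" "\<tau> j = \<sigma> i" using perms_surj[OF \<tau>] perms_in_D[OF \<sigma>] SD(1) by blast
      then show "\<sigma> i \<in> \<tau> ` W" using i unfolding W_def by (intro rev_image_eqI[of j]) auto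
    qed
  qed (auto simp: W_def)
  then have cW: "card W = k"
    using card_image[OF perms_inj_on[OF \<tau>], of W] card_image[OF perms_inj_on[OF \<sigma>], of S] SD(2) by simp
  have fW: "finite W" by (simp add: W_def)
  have o: "overlap S \<sigma> \<tau> = S \<inter> W" using SD by (auto simp: overlap_def W_def)
  have "card S + card W = card (S \<union> W) + card (S \<inter> W)"
    by (rule card_Un_Int) (use SD fW in auto)
  then have u: "card (S \<union> W) + card (overlap S \<sigma> \<tau>) = 2 * k" using cW SD o by simp
  have "{i \<in> D - S. \<tau> i \<notin> \<sigma> ` S} = D - (S \<union> W)" by (auto simp: W_def)
  moreover have "S \<union> W \<subseteq> D" using SD by (auto simp: W_def)
  ultimately have "card {i \<in> D - S. \<tau> i \<notin> \<sigma> ` S} = card D - card (S \<union> W)"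
    using finite_subset[OF _ finite_D] by (simp add: card_Diff_subset)
  then show ?thesis using u n by linarith
qed

text \<open>The two prescriptions are compatible exactly when they glue to a partial injection. This
  fails if S' contains a point of S where \<sigma> and \<tau> differ, or a point outside S at which
  \<tau> repeats a value of \<sigma> on S.\<close>

lemma card_perms_agree_two:
  assumes \<sigma>: "\<sigma> \<in> perms" and \<tau>: "\<tau> \<in> perms" and S: "S \<subseteq> D" and S': "S' \<subseteq> D"
  shows "card {\<rho> \<in> cyl S \<sigma>. \<forall>i\<in>S'. \<rho> i = \<tau> i} =
    (if S' \<subseteq> coinc S \<sigma> \<tau> \<union> {i \<in> D - S. \<tau> i \<notin> \<sigma> ` S} then fact (card D - card (S \<union> S')) else 0)"
proof (cases "S' \<subseteq> coinc S \<sigma> \<tau> \<union> {i \<in> D - S. \<tau> i \<notin> \<sigma> ` S}")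
  case True
  let ?p = "\<lambda>i. if i \<in> S then \<sigma> i else \<tau> i"
  have "{\<rho> \<in> cyl S \<sigma>. \<forall>i\<in>S'. \<rho> i = \<tau> i} = {\<rho> \<in> perms. \<forall>i\<in>S \<union> S'. \<rho> i = ?p i}"
    using True by (fastforce simp: cyl_def coinc_def split: if_splits)
  moreover have key: "\<tau> y \<noteq> \<sigma> x" if "x \<in> S" "y \<in> S'" "y \<notin> S" for x y
    using True that by (auto simp: coinc_def)
  moreover have "inj_on ?p (S \<union> S')"
  proof (rule inj_onI)
    fix x y assume "x \<in> S \<union> S'" "y \<in> S \<union> S'" "?p x = ?p y"
    then show "x = y"
      using key[of x y] key[of y x] perms_eq_iff[OF \<sigma>] perms_eq_iff[OF \<tau>]
      by (cases "x \<in> S"; cases "y \<in> S") auto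
  qed
  moreover have "?p ` (S \<union> S') \<subseteq> D" using S S' perms_in_D \<sigma> \<tau> by auto
  ultimately show ?thesis using True S S' card_perms_extending[of "S \<union> S'" ?p] by simp
next
  case False
  then obtain i where i: "i \<in> S'" "i \<notin> coinc S \<sigma> \<tau>" "i \<notin> {i \<in> D - S. \<tau> i \<notin> \<sigma> ` S}" by auto
  have False if r: "\<rho> \<in> perms" "\<forall>i\<in>S. \<rho> i = \<sigma> i" "\<forall>i\<in>S'. \<rho> i = \<tau> i" for \<rho>
  proof (cases "i \<in> S")
    case True
    then show ?thesis using r i by (auto simp: coinc_def)
  next
    case False
    then obtain i' where "i' \<in> S" "\<tau> i = \<sigma> i'" using i S' by auto
    then have "\<rho> i = \<rho> i'" using r i by auto
    then show ?thesis using perms_eq_iff[OF r(1)] False \<open>i' \<in> S\<close> by auto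
  qed
  then have "{\<rho> \<in> cyl S \<sigma>. \<forall>i\<in>S'. \<rho> i = \<tau> i} = {}" by (auto simp: cyl_def)
  then show ?thesis using False by (simp only: card.empty if_False)
qed

text \<open>Count pairs of \<rho> in the cylinder and a k-set S' on which \<rho> agrees with \<tau>.
  A compatible S' splits into Q inside \<open>coinc\<close> and k - |Q| free positions; then S
  \<union> S' has 2k - |Q| points, which leaves the factorial of n - 2k + |Q|.\<close>

lemma cyl_kernel_eq:
  assumes \<sigma>: "\<sigma> \<in> perms" and \<tau>: "\<tau> \<in> perms" and S: "S \<in> subsets k" and n: "2 * k \<le> card D"
  shows "cyl_kernel k S \<sigma> \<tau> = (\<Sum>Q\<in>Pow (coinc S \<sigma> \<tau>).
      real ((card D - 2 * k + card (overlap S \<sigma> \<tau>)) choose (k - card Q)) * fact (card D - 2 * k + card Q))"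
proof -
  note SD = subsetsD[OF S]
  define E where "E = coinc S \<sigma> \<tau>"
  define N where "N = {i \<in> D - S. \<tau> i \<notin> \<sigma> ` S}"
  have fE: "finite E" using SD by (simp add: E_def coinc_def)
  have fN: "finite N" by (simp add: N_def)
  have ES: "E \<subseteq> S" by (auto simp: E_def coinc_def)
  have NS: "N \<inter> S = {}" "N \<subseteq> D" by (auto simp: N_def)
  have cN: "card N = card D - 2 * k + card (overlap S \<sigma> \<tau>)"
    unfolding N_def using card_free_positions[OF \<sigma> \<tau> S n] .
  have cE: "card Q \<le> k" if "Q \<subseteq> E" for Q
    using that ES SD by (metis card_mono order_trans)
  have "cyl_kernel k S \<sigma> \<tau> = (\<Sum>S'\<in>subsets k. \<Sum>\<rho>\<in>cyl S \<sigma>. if \<forall>i\<in>S'. \<rho> i = \<tau> i then 1 else 0)"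
    unfolding cyl_kernel_def agree_choose_eq_sum by (rule sum.swap)
  also have "\<dots> = (\<Sum>S'\<in>subsets k. real (card {\<rho> \<in> cyl S \<sigma>. \<forall>i\<in>S'. \<rho> i = \<tau> i}))"
    by (simp add: sum.If_cases Int_def)
  also have "\<dots> = (\<Sum>S'\<in>subsets k. if S' \<subseteq> E \<union> N then fact (card D - card (S \<union> S')) else 0)"
    using SD by (intro sum.cong refl, subst card_perms_agree_two[OF \<sigma> \<tau>])
      (auto simp: subsets_def E_def N_def)
  also have "\<dots> = (\<Sum>S'\<in>{S' \<in> subsets k. S' \<subseteq> E \<union> N}. fact (card D - card (S \<union> S')))"
    by (simp add: sum.If_cases Int_def)
  also have "\<dots> = (\<Sum>x\<in>(SIGMA Q:Pow E. {W. W \<subseteq> N \<and> card W = k - card Q}). fact (card D - 2 * k + card (fst x)))"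
  proof (rule sum.reindex_bij_witness[where i = "\<lambda>x. fst x \<union> snd x" and j = "\<lambda>S'. (S' \<inter> E, S' \<inter> N)"], goal_cases)
    case (1 S')
    then show ?case by auto
  next
    case (2 S')
    then have s: "S' \<subseteq> E \<union> N" "card S' = k" "finite S'" by (auto simp: subsetsD)
    have "card S' = card (S' \<inter> E) + card (S' \<inter> N)"
      using s ES NS by (subst card_Un_disjoint[symmetric]) (auto intro!: arg_cong[where f = card])
    then show ?case using s by auto
  next
    case (3 x)
    then show ?case using ES NS by (cases x) auto
  next
    case (4 x)
    then obtain Q W where x: "x = (Q, W)" "Q \<subseteq> E" "W \<subseteq> N" "card W = k - card Q" by auto
    have "card (Q \<union> W) = card Q + card W"
      using x ES NS fE fN finite_subset by (intro card_Un_disjoint) blast+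
    then have "card (Q \<union> W) = k" using x cE[of Q] by simp
    moreover have "Q \<union> W \<subseteq> D" using x ES NS SD by auto
    ultimately show ?case using x by (auto simp: subsets_def)
  next
    case (5 S')
    then have s: "S' \<subseteq> E \<union> N" "card S' = k" "finite S'" by (auto simp: subsetsD)
    have 1: "card S' = card (S' \<inter> E) + card (S' \<inter> N)"
      using s ES NS by (subst card_Un_disjoint[symmetric]) (auto intro!: arg_cong[where f = card])
    have "S \<union> S' = S \<union> (S' \<inter> N)" using s ES by auto
    then have "card (S \<union> S') = k + card (S' \<inter> N)"
      using s NS SD by (simp, subst card_Un_disjoint) auto
    then have "card D - 2 * k + card (fst (S' \<inter> E, S' \<inter> N)) = card D - card (S \<union> S')"
      using 1 s n by simp
    then show ?case by simp
  qed
  also have "\<dots> = (\<Sum>Q\<in>Pow E. \<Sum>W\<in>{W. W \<subseteq> N \<and> card W = k - card Q}. fact (card D - 2 * k + card Q))"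
    using fE fN by (subst sum.Sigma) (auto simp: case_prod_unfold)
  also have "\<dots> = (\<Sum>Q\<in>Pow E. real (card N choose (k - card Q)) * fact (card D - 2 * k + card Q))"
    using fN by (simp add: n_subsets)
  finally show ?thesis by (simp add: cN E_def)
qed

text \<open>In \<open>cyl_kernel_eq\<close> there are at most 2^k choices of Q, and each contributes
  at most 2^k (n-k)!.\<close>

lemma cyl_kernel_bounds:
  assumes \<sigma>: "\<sigma> \<in> perms" and \<tau>: "\<tau> \<in> perms" and S: "S \<in> subsets k" and n: "4 * k \<le> card D"
  shows "0 \<le> cyl_kernel k S \<sigma> \<tau>" "cyl_kernel k S \<sigma> \<tau> \<le> 4 ^ k * fact (card D - k)"
proof -
  note SD = subsetsD[OF S]
  have n2: "2 * k \<le> card D" using n by simp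
  show "0 \<le> cyl_kernel k S \<sigma> \<tau>" by (auto simp: cyl_kernel_def intro: sum_nonneg)
  have fc: "finite (coinc S \<sigma> \<tau>)" "coinc S \<sigma> \<tau> \<subseteq> S" using SD by (auto simp: coinc_def)
  have cc: "card (coinc S \<sigma> \<tau>) \<le> k" using SD fc by (metis card_mono)
  have co: "card (overlap S \<sigma> \<tau>) \<le> k" using SD card_mono[of S "overlap S \<sigma> \<tau>"] by (auto simp: overlap_def)
  have "cyl_kernel k S \<sigma> \<tau> \<le> (\<Sum>Q\<in>Pow (coinc S \<sigma> \<tau>). 2 ^ k * fact (card D - k))"
    unfolding cyl_kernel_eq[OF \<sigma> \<tau> S n2]
  proof (rule sum_mono)
    fix Q assume "Q \<in> Pow (coinc S \<sigma> \<tau>)"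
    then have "card Q \<le> k" using cc fc card_mono[of "coinc S \<sigma> \<tau>" Q] by auto
    then show "real ((card D - 2 * k + card (overlap S \<sigma> \<tau>)) choose (k - card Q)) * fact (card D - 2 * k + card Q)
        \<le> 2 ^ k * fact (card D - k)"
      using n co by (intro choose_mult_fact_le) auto
  qed
  also have "\<dots> = 2 ^ card (coinc S \<sigma> \<tau>) * (2 ^ k * fact (card D - k))"
    using fc by (simp add: card_Pow)
  also have "\<dots> \<le> 2 ^ k * (2 ^ k * fact (card D - k))"
    using cc by (intro mult_right_mono power_increasing) auto
  also have "\<dots> = 4 ^ k * fact (card D - k)"
    by (simp add: mult.assoc[symmetric] power_mult_distrib[symmetric])
  finally show "cyl_kernel k S \<sigma> \<tau> \<le> 4 ^ k * fact (card D - k)" .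
qed

text \<open>If the overlap has at most one element, the cardinalities of \<open>overlap\<close> and
  \<open>coinc\<close> are (0,0), (1,0) or (1,1), so an affine function with three coefficients
  interpolates the kernel exactly. The coefficients are uniform in S, \<sigma> and \<tau>, and an
  error arises only from two shared values.\<close>

lemma cyl_kernel_linear:
  assumes k: "1 \<le> k" and n: "4 * k \<le> card D"
  obtains d c0 c1 :: real where
    "\<bar>c0\<bar> \<le> 4 ^ k * fact (card D - k)" "\<bar>c1\<bar> \<le> 4 ^ k * fact (card D - k)"
    "\<And>S \<sigma> \<tau>. S \<in> subsets k \<Longrightarrow> \<sigma> \<in> perms \<Longrightarrow> \<tau> \<in> perms \<Longrightarrow>
       \<bar>cyl_kernel k S \<sigma> \<tau> - (d + c0 * card (overlap S \<sigma> \<tau>) + (c1 - c0) * card (coinc S \<sigma> \<tau>))\<bar>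
       \<le> (if card (overlap S \<sigma> \<tau>) \<ge> 2 then (2 * real k + 1) * (4 ^ k * fact (card D - k)) else 0)"
proof -
  define B where "B = (4 ^ k * fact (card D - k) :: real)"
  define m where "m = card D - 2 * k"
  \<comment> \<open>\<open>d\<close>, \<open>p0\<close>, \<open>p1\<close> are the values of the
    kernel at (0,0), (1,0) and (1,1); the slopes are their differences from
    \<open>d\<close>.\<close>
  define d where "d = (real (m choose k) * fact m)"
  define p0 where "p0 = (real ((m + 1) choose k) * fact m)"
  define p1 where "p1 = (p0 + real ((m + 1) choose (k - 1)) * fact (m + 1))"
  have n2: "2 * k \<le> card D" using n by simp
  \<comment> \<open>\<open>p1\<close> is a sum of two terms of size at most 2^k (n-k)!, so a
    doubling has to fit into 4^k (n-k)!; this is where k \<ge> 1 enters.\<close>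
  have "2 * (2 ^ k * fact (card D - k)) \<le> 2 ^ k * (2 ^ k * fact (card D - k) :: real)"
    using k self_le_power[of "2::real" k] by (intro mult_right_mono) auto
  then have B2: "2 * (2 ^ k * fact (card D - k)) \<le> B"
    by (simp add: B_def mult.assoc[symmetric] power_mult_distrib[symmetric])
  have b: "d \<le> 2 ^ k * fact (card D - k)" "p0 \<le> 2 ^ k * fact (card D - k)"
    "real ((m + 1) choose (k - 1)) * fact (m + 1) \<le> 2 ^ k * fact (card D - k)"
    using choose_mult_fact_le[of k "card D" 0 m] choose_mult_fact_le[of k "card D" 0 "m + 1"]
      choose_mult_fact_le[of k "card D" 1 "m + 1"] n k
    by (auto simp: d_def p0_def m_def)
  have nn: "0 \<le> d" "0 \<le> p0" "p0 \<le> p1" by (auto simp: d_def p0_def p1_def)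
  have le: "d \<le> B" "p0 \<le> B" "p1 \<le> B" using b B2 nn unfolding p1_def by linarith+
  have c0: "\<bar>p0 - d\<bar> \<le> B" and c1: "\<bar>p1 - d\<bar> \<le> B" using le nn by linarith+
  have main: "\<bar>cyl_kernel k S \<sigma> \<tau> - (d + (p0 - d) * card (overlap S \<sigma> \<tau>) + ((p1 - d) - (p0 - d)) * card (coinc S \<sigma> \<tau>))\<bar>
       \<le> (if card (overlap S \<sigma> \<tau>) \<ge> 2 then (2 * real k + 1) * B else 0)"
    if S: "S \<in> subsets k" and \<sigma>: "\<sigma> \<in> perms" and \<tau>: "\<tau> \<in> perms" for S \<sigma> \<tau>
  proof -
    note SD = subsetsD[OF S]
    define y where "y = card (overlap S \<sigma> \<tau>)"
    define e where "e = card (coinc S \<sigma> \<tau>)"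
    have fo: "finite (overlap S \<sigma> \<tau>)" using SD by (simp add: overlap_def)
    then have fc: "finite (coinc S \<sigma> \<tau>)" using coinc_subset_overlap finite_subset by metis
    have ey: "e \<le> y" unfolding e_def y_def using fo coinc_subset_overlap by (rule card_mono)
    have yk: "y \<le> k" using SD card_mono[of S "overlap S \<sigma> \<tau>"] by (auto simp: overlap_def y_def)
    note form = cyl_kernel_eq[OF \<sigma> \<tau> S n2, folded m_def y_def]
    consider "y = 0" | "y = 1" "e = 0" | "y = 1" "e = 1" | "y \<ge> 2" using ey by linarith
    then show ?thesis
    proof cases
      case 1
      then have "coinc S \<sigma> \<tau> = {}" using ey fc e_def by simp
      then show ?thesis using 1 by (simp add: form d_def flip: y_def)
    next
      case 2
      then have "coinc S \<sigma> \<tau> = {}" using fc e_def by simp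
      then show ?thesis using 2 by (simp add: form p0_def flip: y_def)
    next
      case 3
      then obtain x where "coinc S \<sigma> \<tau> = {x}" using e_def card_1_singletonE by metis
      moreover have "Pow {x} = {{}, {x}}" by auto
      ultimately show ?thesis using 3 by (simp add: form p0_def p1_def flip: y_def)
    next
      case 4
      have K: "0 \<le> cyl_kernel k S \<sigma> \<tau>" "cyl_kernel k S \<sigma> \<tau> \<le> B"
        using cyl_kernel_bounds[OF \<sigma> \<tau> S n] by (auto simp: B_def)
      \<comment> \<open>Crude bounds suffice here: B for the deviation from \<open>d\<close> and B k
        for each of the two slope terms, which add up to (2k+1) B.\<close>
      have "\<bar>cyl_kernel k S \<sigma> \<tau> - d\<bar> \<le> B" using K nn le by linarith
      moreover have "\<bar>(p0 - d) * (real y - real e)\<bar> \<le> B * k"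
        unfolding abs_mult using c0 ey yk by (intro mult_mono) auto
      moreover have "\<bar>(p1 - d) * real e\<bar> \<le> B * k"
        unfolding abs_mult using c1 ey yk by (intro mult_mono) auto
      moreover have "cyl_kernel k S \<sigma> \<tau> - (d + (p0 - d) * y + ((p1 - d) - (p0 - d)) * e)
          = (cyl_kernel k S \<sigma> \<tau> - d) - (p0 - d) * (real y - real e) - (p1 - d) * real e"
        by (simp add: algebra_simps)
      ultimately have "\<bar>cyl_kernel k S \<sigma> \<tau> - (d + (p0 - d) * y + ((p1 - d) - (p0 - d)) * e)\<bar> \<le> B + B * k + B * k"
        by linarith
      then show ?thesis using 4 by (simp add: y_def e_def algebra_simps)
    qed
  qed
  show ?thesis by (rule that[OF c0[unfolded B_def] c1[unfolded B_def] main[unfolded B_def]])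
qed

subsection \<open>Agreement forms\<close>

definition csum :: "'a set \<Rightarrow> (('a \<Rightarrow> 'a) \<Rightarrow> real) \<Rightarrow> ('a \<Rightarrow> 'a) \<Rightarrow> real" where
  "csum S f \<sigma> = (\<Sum>\<rho>\<in>cyl S \<sigma>. f \<rho>)"

definition agree_form :: "nat \<Rightarrow> (('a \<Rightarrow> 'a) \<Rightarrow> real) \<Rightarrow> (('a \<Rightarrow> 'a) \<Rightarrow> real) \<Rightarrow> real" where
  "agree_form k f g = (\<Sum>\<sigma>\<in>perms. \<Sum>\<tau>\<in>perms. f \<sigma> * g \<tau> * real (card (agree \<sigma> \<tau>) choose k))"

definition psum :: "(('a \<Rightarrow> 'a) \<Rightarrow> real) \<Rightarrow> 'a \<Rightarrow> 'a \<Rightarrow> real" where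
  "psum f i j = (\<Sum>\<sigma>\<in>{\<sigma> \<in> perms. \<sigma> i = j}. f \<sigma>)"

text \<open>For the centred indicator of a family this is the sum, over all stars, of the squared
  deviation of the star size from its average.\<close>

definition energy :: "(('a \<Rightarrow> 'a) \<Rightarrow> real) \<Rightarrow> real" where
  "energy f = (\<Sum>i\<in>D. \<Sum>j\<in>D. (psum f i j)\<^sup>2)"

lemma psum_eq_if: "psum f i j = (\<Sum>\<sigma>\<in>perms. if \<sigma> i = j then f \<sigma> else 0)"
  by (simp add: psum_def sum.inter_filter)

lemma csum_eq_if: "csum S f \<sigma> = (\<Sum>\<rho>\<in>perms. if \<forall>i\<in>S. \<rho> i = \<sigma> i then f \<rho> else 0)"
  by (simp add: csum_def cyl_def sum.inter_filter)

lemma csum_cong: "\<tau> \<in> cyl S \<sigma> \<Longrightarrow> csum S f \<tau> = csum S f \<sigma>"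
  unfolding csum_eq_if by (intro sum.cong) (auto simp: cyl_def)

lemma agree_sym: "agree \<sigma> \<tau> = agree \<tau> \<sigma>"
  by (auto simp: agree_def)

lemma agree_form_eq_csum:
  "agree_form k f g = (\<Sum>S\<in>subsets k. \<Sum>\<sigma>\<in>perms. f \<sigma> * csum S g \<sigma>)"
proof -
  have "agree_form k f g = (\<Sum>\<sigma>\<in>perms. \<Sum>\<tau>\<in>perms. \<Sum>S\<in>subsets k. if \<forall>i\<in>S. \<tau> i = \<sigma> i then f \<sigma> * g \<tau> else 0)"
  proof -
    have "agree_form k f g = (\<Sum>\<sigma>\<in>perms. \<Sum>\<tau>\<in>perms. f \<sigma> * g \<tau> * real (card (agree \<tau> \<sigma>) choose k))"
      unfolding agree_form_def by (intro sum.cong refl) (simp add: agree_sym)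
    then show ?thesis
      unfolding agree_choose_eq_sum sum_distrib_left by (simp add: if_distrib cong: if_cong)
  qed
  also have "\<dots> = (\<Sum>\<sigma>\<in>perms. \<Sum>S\<in>subsets k. \<Sum>\<tau>\<in>perms. if \<forall>i\<in>S. \<tau> i = \<sigma> i then f \<sigma> * g \<tau> else 0)"
    by (intro sum.cong refl sum.swap)
  also have "\<dots> = (\<Sum>S\<in>subsets k. \<Sum>\<sigma>\<in>perms. \<Sum>\<tau>\<in>perms. if \<forall>i\<in>S. \<tau> i = \<sigma> i then f \<sigma> * g \<tau> else 0)"
    by (rule sum.swap)
  also have "\<dots> = (\<Sum>S\<in>subsets k. \<Sum>\<sigma>\<in>perms. f \<sigma> * csum S g \<sigma>)"
    unfolding csum_eq_if sum_distrib_left by (intro sum.cong refl) auto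
  finally show ?thesis .
qed

text \<open>\<open>csum S\<close> is (n-k)! times the orthogonal projection onto the functions
  constant on the cylinders of S. Since U is such a function, pairing with it does not see the
  projection.\<close>

lemma sum_csum_mult:
  assumes S: "S \<in> subsets k" and U: "\<And>\<sigma> \<tau>. \<sigma> \<in> perms \<Longrightarrow> \<tau> \<in> cyl S \<sigma> \<Longrightarrow> U \<tau> = U \<sigma>"
  shows "(\<Sum>\<sigma>\<in>perms. csum S f \<sigma> * U \<sigma>) = fact (card D - k) * (\<Sum>\<sigma>\<in>perms. f \<sigma> * U \<sigma>)"
proof -
  have "(\<Sum>\<sigma>\<in>perms. csum S f \<sigma> * U \<sigma>) = (\<Sum>\<sigma>\<in>perms. \<Sum>\<rho>\<in>perms. if \<forall>i\<in>S. \<rho> i = \<sigma> i then f \<rho> * U \<sigma> else 0)"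
    unfolding csum_eq_if sum_distrib_right by (intro sum.cong refl) auto
  also have "\<dots> = (\<Sum>\<rho>\<in>perms. \<Sum>\<sigma>\<in>perms. if \<forall>i\<in>S. \<rho> i = \<sigma> i then f \<rho> * U \<sigma> else 0)"
    by (rule sum.swap)
  also have "\<dots> = (\<Sum>\<rho>\<in>perms. \<Sum>\<sigma>\<in>perms. if \<sigma> \<in> cyl S \<rho> then f \<rho> * U \<rho> else 0)"
  proof (intro sum.cong refl)
    fix \<rho> \<sigma> assume r: "\<rho> \<in> perms" "\<sigma> \<in> perms"
    then have "(\<forall>i\<in>S. \<rho> i = \<sigma> i) \<longleftrightarrow> \<sigma> \<in> cyl S \<rho>" by (auto simp: cyl_def)
    then show "(if \<forall>i\<in>S. \<rho> i = \<sigma> i then f \<rho> * U \<sigma> else 0) = (if \<sigma> \<in> cyl S \<rho> then f \<rho> * U \<rho> else 0)"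
      using U[OF r(1), of \<sigma>] by presburger
  qed
  also have "\<dots> = (\<Sum>\<rho>\<in>perms. real (card (cyl S \<rho>)) * (f \<rho> * U \<rho>))"
    using cyl_subset by (intro sum.cong refl) (simp add: sum.If_cases Int_absorb1 flip: Int_def)
  also have "\<dots> = (\<Sum>\<rho>\<in>perms. fact (card D - k) * (f \<rho> * U \<rho>))"
    using card_cyl[OF _ S] by (intro sum.cong refl) simp
  finally show ?thesis by (simp add: sum_distrib_left)
qed

text \<open>Up to a factor, the form is a sum over S of inner products of cylinder sums; positivity
  and Cauchy--Schwarz for \<open>agree_form\<close> are read off from this.\<close>

lemma fact_agree_form:
  "fact (card D - k) * agree_form k f g = (\<Sum>S\<in>subsets k. \<Sum>\<sigma>\<in>perms. csum S f \<sigma> * csum S g \<sigma>)"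
  unfolding agree_form_eq_csum sum_distrib_left[of _ _ "subsets k"]
  by (intro sum.cong refl sum_csum_mult[symmetric] csum_cong)

lemma fact_agree_form_self:
  "fact (card D - k) * agree_form k f f = (\<Sum>S\<in>subsets k. \<Sum>\<sigma>\<in>perms. (csum S f \<sigma>)\<^sup>2)"
  by (simp add: fact_agree_form power2_eq_square)

lemma agree_form_nonneg: "0 \<le> agree_form k f f"
proof -
  have "0 \<le> fact (card D - k) * agree_form k f f"
    unfolding fact_agree_form_self by (intro sum_nonneg) auto
  then show ?thesis by (simp add: zero_le_mult_iff) (meson fact_gt_zero not_le)
qed

lemma agree_form_Cauchy_Schwarz: "(agree_form k f g)\<^sup>2 \<le> agree_form k f f * agree_form k g g"
proof -
  let ?c = "fact (card D - k) :: real"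
  have "(?c * agree_form k f g)\<^sup>2 \<le> (?c * agree_form k f f) * (?c * agree_form k g g)"
    unfolding fact_agree_form_self fact_agree_form[of k f g] sum.cartesian_product case_prod_unfold
    by (rule Cauchy_Schwarz_ineq_sum)
  also have "\<dots> = ?c\<^sup>2 * (agree_form k f f * agree_form k g g)"
    by (simp add: power2_eq_square)
  finally show ?thesis by (simp add: power_mult_distrib)
qed

lemma subsets_one: "subsets 1 = (\<lambda>i. {i}) ` D"
  by (auto simp: subsets_def card_1_singleton_iff)

text \<open>For S = {i} the cylinder sum at \<sigma> is \<open>psum f i (\<sigma> i)\<close>. Each
  \<open>psum f i j\<close> is taken at the (n-1)! permutations of a star, which cancels the
  prefactor.\<close>

lemma agree_form_one: "agree_form 1 f f = energy f"
proof -
  have "fact (card D - 1) * agree_form 1 f f = (\<Sum>i\<in>D. \<Sum>\<sigma>\<in>perms. (csum {i} f \<sigma>)\<^sup>2)"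
    unfolding fact_agree_form_self subsets_one by (subst sum.reindex) auto
  also have "\<dots> = (\<Sum>i\<in>D. \<Sum>\<sigma>\<in>perms. (psum f i (\<sigma> i))\<^sup>2)"
    by (simp add: csum_def cyl_def psum_def)
  also have "\<dots> = (\<Sum>i\<in>D. fact (card D - 1) * (\<Sum>j\<in>D. (psum f i j)\<^sup>2))"
    by (intro sum.cong refl sum_perms_point)
  also have "\<dots> = fact (card D - 1) * energy f"
    by (simp add: energy_def sum_distrib_left)
  finally show ?thesis by simp
qed

section \<open>Sets through a point and permutations with two shared values\<close>

lemma card_subsets_containing:
  assumes "i \<in> D" "1 \<le> k"
  shows "card {S \<in> subsets k. i \<in> S} = (card D - 1) choose (k - 1)"
proof -
  have "{S \<in> subsets k. i \<in> S} = insert i ` {T. T \<subseteq> D - {i} \<and> card T = k - 1}"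
  proof
    show "{S \<in> subsets k. i \<in> S} \<subseteq> insert i ` {T. T \<subseteq> D - {i} \<and> card T = k - 1}"
    proof clarify
      fix S assume "S \<in> subsets k" "i \<in> S"
      then show "S \<in> insert i ` {T. T \<subseteq> D - {i} \<and> card T = k - 1}"
        using subsetsD[of S k] by (intro image_eqI[of _ _ "S - {i}"]) (auto simp: card_Diff_singleton)
    qed
    show "insert i ` {T. T \<subseteq> D - {i} \<and> card T = k - 1} \<subseteq> {S \<in> subsets k. i \<in> S}"
    proof clarify
      fix T assume T: "T \<subseteq> D - {i}" "card T = k - 1"
      then have "finite T" by (meson finite_D finite_Diff finite_subset)
      moreover have "i \<notin> T" using T by auto
      ultimately show "insert i T \<in> subsets k \<and> i \<in> insert i T"
        using T assms by (auto simp: subsets_def)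
    qed
  qed
  moreover have "inj_on (insert i) {T. T \<subseteq> D - {i} \<and> card T = k - 1}"
    by (rule inj_onI) (metis (no_types, lifting) Diff_insert_absorb mem_Collect_eq subset_Diff_insert)
  ultimately show ?thesis
    using assms by (simp add: card_image n_subsets)
qed

text \<open>The event of at least two shared values, phrased with witnesses on both sides so that it
  is symmetric in \<sigma> and \<tau>.\<close>

definition overlap2 :: "'a set \<Rightarrow> ('a \<Rightarrow> 'a) \<Rightarrow> ('a \<Rightarrow> 'a) \<Rightarrow> bool" where
  "overlap2 S \<sigma> \<tau> \<longleftrightarrow> (\<exists>a\<in>S. \<exists>b\<in>S. \<exists>c\<in>S. \<exists>d\<in>S. a \<noteq> b \<and> c \<noteq> d \<and> \<tau> a = \<sigma> c \<and> \<tau> b = \<sigma> d)"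

lemma overlap2_sym: "overlap2 S \<sigma> \<tau> \<longleftrightarrow> overlap2 S \<tau> \<sigma>"
proof -
  have "overlap2 S \<tau> \<sigma>" if ov: "overlap2 S \<sigma> \<tau>" for \<sigma> \<tau> :: "'a \<Rightarrow> 'a"
  proof -
    obtain a b c d where "a \<in> S" "b \<in> S" "c \<in> S" "d \<in> S" "a \<noteq> b" "c \<noteq> d" "\<tau> a = \<sigma> c" "\<tau> b = \<sigma> d"
      using ov unfolding overlap2_def by blast
    then show ?thesis unfolding overlap2_def
      by (intro bexI[of _ c] bexI[of _ d] bexI[of _ a] bexI[of _ b]) auto
  qed
  then show ?thesis by blast
qed

lemma overlap2I:
  assumes "\<tau> \<in> perms" "2 \<le> card (overlap S \<sigma> \<tau>)"
  shows "overlap2 S \<sigma> \<tau>"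
proof -
  obtain T where "T \<subseteq> overlap S \<sigma> \<tau>" "card T = 2"
    using obtain_subset_with_card_n[OF assms(2)] by metis
  then obtain a b where ab: "a \<noteq> b" "a \<in> overlap S \<sigma> \<tau>" "b \<in> overlap S \<sigma> \<tau>"
    by (auto simp: card_2_iff)
  then obtain c d where "c \<in> S" "d \<in> S" "\<tau> a = \<sigma> c" "\<tau> b = \<sigma> d" "a \<in> S" "b \<in> S"
    by (auto simp: overlap_def)
  then show ?thesis unfolding overlap2_def using ab perms_eq_iff[OF assms(1), of a b] by metis
qed

text \<open>Union bound over the k^4 quadruples of witnesses, each of which prescribes two values of
  \<tau>.\<close>

lemma card_overlap2_le:
  assumes S: "S \<in> subsets k" and \<sigma>: "\<sigma> \<in> perms"
  shows "card {\<tau> \<in> perms. overlap2 S \<sigma> \<tau>} \<le> k ^ 4 * fact (card D - 2)"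
proof -
  note SD = subsetsD[OF S]
  define I where "I = S \<times> S \<times> S \<times> S"
  define W where "W = (\<lambda>(a, b, c, d). {\<tau> \<in> perms. a \<noteq> b \<and> c \<noteq> d \<and> \<tau> a = \<sigma> c \<and> \<tau> b = \<sigma> d})"
  have fI: "finite I" using SD by (simp add: I_def)
  have "{\<tau> \<in> perms. overlap2 S \<sigma> \<tau>} \<subseteq> (\<Union>x\<in>I. W x)"
    by (fastforce simp: overlap2_def I_def W_def)
  then have "card {\<tau> \<in> perms. overlap2 S \<sigma> \<tau>} \<le> card (\<Union>x\<in>I. W x)"
    by (rule card_mono[rotated]) (use fI in \<open>auto simp: W_def\<close>)
  also have "\<dots> \<le> (\<Sum>x\<in>I. card (W x))" by (rule card_UN_le[OF fI])
  also have "\<dots> \<le> (\<Sum>x\<in>I. fact (card D - 2))"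
  proof (rule sum_mono)
    fix x assume "x \<in> I"
    then obtain a b c d where x: "x = (a, b, c, d)" "a \<in> S" "b \<in> S" "c \<in> S" "d \<in> S"
      by (auto simp: I_def)
    show "card (W x) \<le> fact (card D - 2)"
    proof (cases "a \<noteq> b \<and> c \<noteq> d")
      case True
      then have "W x = {\<tau> \<in> perms. \<tau> a = \<sigma> c \<and> \<tau> b = \<sigma> d}" by (auto simp: W_def x)
      also have "card \<dots> = fact (card D - 2)"
        using True x SD perms_in_D[OF \<sigma>] perms_eq_iff[OF \<sigma>] by (intro card_perms_two_points) auto
      finally show ?thesis by simp
    next
      case False
      then have "W x = {}" by (auto simp: W_def x)
      then show ?thesis by (simp only: card.empty)
    qed
  qed
  also have "\<dots> = k ^ 4 * fact (card D - 2)"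
    using SD by (simp add: I_def card_cartesian_product power4_eq_xxxx algebra_simps)
  finally show ?thesis .
qed

subsection \<open>The large sieve\<close>

text \<open>\<open>lin_part\<close> dominates the contribution of the affine part of the kernel, and
  \<open>rem_part\<close> below that of the pairs with two shared values.\<close>

definition lin_part :: "'a set \<Rightarrow> (('a \<Rightarrow> 'a) \<Rightarrow> real) \<Rightarrow> ('a \<Rightarrow> 'a) \<Rightarrow> real" where
  "lin_part S f \<sigma> = (\<Sum>i\<in>S. \<Sum>i'\<in>S. \<bar>psum f i (\<sigma> i')\<bar>)"

definition rem_part :: "'a set \<Rightarrow> (('a \<Rightarrow> 'a) \<Rightarrow> real) \<Rightarrow> ('a \<Rightarrow> 'a) \<Rightarrow> real" where
  "rem_part S f \<sigma> = (\<Sum>\<tau>\<in>{\<tau> \<in> perms. overlap2 S \<sigma> \<tau>}. \<bar>f \<tau>\<bar>)"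

lemma sum_mult_card_overlap:
  fixes f :: "('a \<Rightarrow> 'a) \<Rightarrow> real"
  assumes "\<sigma> \<in> perms" "finite S"
  shows "(\<Sum>\<tau>\<in>perms. f \<tau> * card (overlap S \<sigma> \<tau>)) = (\<Sum>i\<in>S. \<Sum>i'\<in>S. psum f i (\<sigma> i'))"
proof -
  have "(\<Sum>\<tau>\<in>perms. f \<tau> * card (overlap S \<sigma> \<tau>))
      = (\<Sum>\<tau>\<in>perms. \<Sum>i\<in>S. \<Sum>i'\<in>S. if \<tau> i = \<sigma> i' then f \<tau> else 0)"
    unfolding card_overlap_eq_sum[OF assms] sum_distrib_left by (intro sum.cong refl) auto
  also have "\<dots> = (\<Sum>i\<in>S. \<Sum>\<tau>\<in>perms. \<Sum>i'\<in>S. if \<tau> i = \<sigma> i' then f \<tau> else 0)"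
    by (rule sum.swap)
  also have "\<dots> = (\<Sum>i\<in>S. \<Sum>i'\<in>S. \<Sum>\<tau>\<in>perms. if \<tau> i = \<sigma> i' then f \<tau> else 0)"
    by (intro sum.cong refl sum.swap)
  finally show ?thesis by (simp add: psum_eq_if)
qed

lemma sum_mult_card_coinc:
  fixes f :: "('a \<Rightarrow> 'a) \<Rightarrow> real"
  assumes "finite S"
  shows "(\<Sum>\<tau>\<in>perms. f \<tau> * card (coinc S \<sigma> \<tau>)) = (\<Sum>i\<in>S. psum f i (\<sigma> i))"
proof -
  have "(\<Sum>\<tau>\<in>perms. f \<tau> * card (coinc S \<sigma> \<tau>)) = (\<Sum>\<tau>\<in>perms. \<Sum>i\<in>S. if \<tau> i = \<sigma> i then f \<tau> else 0)"
    unfolding card_coinc_eq_sum[OF assms] sum_distrib_left by (intro sum.cong refl) auto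
  also have "\<dots> = (\<Sum>i\<in>S. \<Sum>\<tau>\<in>perms. if \<tau> i = \<sigma> i then f \<tau> else 0)"
    by (rule sum.swap)
  finally show ?thesis by (simp add: psum_eq_if)
qed

text \<open>When f is summed against the affine approximation of the kernel, the constant disappears
  because f has sum zero, the slopes produce values of \<open>psum\<close>, and the error lives on
  \<open>overlap2\<close>.\<close>

lemma cyl_kernel_sum_le:
  assumes k: "1 \<le> k" and n: "4 * k \<le> card D" and S: "S \<in> subsets k" and \<sigma>: "\<sigma> \<in> perms"
    and f0: "(\<Sum>\<tau>\<in>perms. f \<tau>) = 0"
  shows "\<bar>\<Sum>\<tau>\<in>perms. f \<tau> * cyl_kernel k S \<sigma> \<tau>\<bar>
    \<le> 4 ^ k * fact (card D - k) * (lin_part S f \<sigma> + (2 * real k + 1) * rem_part S f \<sigma>)"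
proof -
  note SD = subsetsD[OF S]
  define B where "B = (4 ^ k * fact (card D - k) :: real)"
  have B0: "0 \<le> B" by (simp add: B_def)
  obtain d c0 c1 :: real where c: "\<bar>c0\<bar> \<le> B" "\<bar>c1\<bar> \<le> B"
    and lin: "\<And>S \<sigma> \<tau>. S \<in> subsets k \<Longrightarrow> \<sigma> \<in> perms \<Longrightarrow> \<tau> \<in> perms \<Longrightarrow>
       \<bar>cyl_kernel k S \<sigma> \<tau> - (d + c0 * card (overlap S \<sigma> \<tau>) + (c1 - c0) * card (coinc S \<sigma> \<tau>))\<bar>
       \<le> (if card (overlap S \<sigma> \<tau>) \<ge> 2 then (2 * real k + 1) * B else 0)"
    using cyl_kernel_linear[OF k n] unfolding B_def by metis
  define E where "E = (\<lambda>\<tau>. cyl_kernel k S \<sigma> \<tau> - (d + c0 * card (overlap S \<sigma> \<tau>) + (c1 - c0) * card (coinc S \<sigma> \<tau>)))"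
  have E: "\<bar>E \<tau>\<bar> \<le> (if overlap2 S \<sigma> \<tau> then (2 * real k + 1) * B else 0)" if "\<tau> \<in> perms" for \<tau>
    using lin[OF S \<sigma> that] overlap2I[OF that, of S \<sigma>] B0 unfolding E_def
    by (auto split: if_splits)
  have "(\<Sum>\<tau>\<in>perms. f \<tau> * cyl_kernel k S \<sigma> \<tau>) = (\<Sum>\<tau>\<in>perms. d * f \<tau> + c0 * (f \<tau> * card (overlap S \<sigma> \<tau>))
      + (c1 - c0) * (f \<tau> * card (coinc S \<sigma> \<tau>)) + f \<tau> * E \<tau>)"
    by (intro sum.cong refl) (simp add: E_def algebra_simps)
  also have "\<dots> = c0 * (\<Sum>i\<in>S. \<Sum>i'\<in>S. psum f i (\<sigma> i')) + (c1 - c0) * (\<Sum>i\<in>S. psum f i (\<sigma> i))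
      + (\<Sum>\<tau>\<in>perms. f \<tau> * E \<tau>)"
    using f0 sum_mult_card_overlap[OF \<sigma> SD(3), of f] sum_mult_card_coinc[OF SD(3), of f \<sigma>]
    by (simp add: sum.distrib flip: sum_distrib_left)
  \<comment> \<open>Collecting the diagonal gives every \<open>psum\<close> the coefficient
    \<open>c0\<close> or \<open>c1\<close>, each at most B, so the difference \<open>c1 - c0\<close>
    causes no loss.\<close>
  also have "c0 * (\<Sum>i\<in>S. \<Sum>i'\<in>S. psum f i (\<sigma> i')) + (c1 - c0) * (\<Sum>i\<in>S. psum f i (\<sigma> i))
      = (\<Sum>i\<in>S. \<Sum>i'\<in>S. (if i' = i then c1 else c0) * psum f i (\<sigma> i'))"
  proof -
    have "(\<Sum>i'\<in>S. (if i' = i then c1 else c0) * psum f i (\<sigma> i'))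
        = c0 * (\<Sum>i'\<in>S. psum f i (\<sigma> i')) + (c1 - c0) * psum f i (\<sigma> i)" if "i \<in> S" for i
    proof -
      have "(\<Sum>i'\<in>S. (if i' = i then c1 else c0) * psum f i (\<sigma> i'))
        = (\<Sum>i'\<in>S. c0 * psum f i (\<sigma> i') + (if i' = i then (c1 - c0) * psum f i (\<sigma> i') else 0))"
        by (intro sum.cong refl) (simp add: algebra_simps)
      then show ?thesis using that SD by (simp add: sum.distrib sum_distrib_left)
    qed
    then show ?thesis by (simp add: sum.distrib sum_distrib_left)
  qed
  finally have eq: "(\<Sum>\<tau>\<in>perms. f \<tau> * cyl_kernel k S \<sigma> \<tau>)
      = (\<Sum>i\<in>S. \<Sum>i'\<in>S. (if i' = i then c1 else c0) * psum f i (\<sigma> i')) + (\<Sum>\<tau>\<in>perms. f \<tau> * E \<tau>)" .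
  have "\<bar>\<Sum>i\<in>S. \<Sum>i'\<in>S. (if i' = i then c1 else c0) * psum f i (\<sigma> i')\<bar> \<le> (\<Sum>i\<in>S. \<Sum>i'\<in>S. B * \<bar>psum f i (\<sigma> i')\<bar>)"
    using c by (intro order_trans[OF sum_abs] sum_mono) (auto simp: abs_mult intro!: mult_right_mono)
  then have 1: "\<bar>\<Sum>i\<in>S. \<Sum>i'\<in>S. (if i' = i then c1 else c0) * psum f i (\<sigma> i')\<bar> \<le> B * lin_part S f \<sigma>"
    by (simp add: lin_part_def sum_distrib_left)
  have "\<bar>\<Sum>\<tau>\<in>perms. f \<tau> * E \<tau>\<bar> \<le> (\<Sum>\<tau>\<in>perms. if overlap2 S \<sigma> \<tau> then (2 * real k + 1) * B * \<bar>f \<tau>\<bar> else 0)"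
  proof (intro order_trans[OF sum_abs] sum_mono)
    fix \<tau> assume "\<tau> \<in> perms"
    then show "\<bar>f \<tau> * E \<tau>\<bar> \<le> (if overlap2 S \<sigma> \<tau> then (2 * real k + 1) * B * \<bar>f \<tau>\<bar> else 0)"
      using E[of \<tau>] mult_left_mono[of "\<bar>E \<tau>\<bar>" "(2 * real k + 1) * B" "\<bar>f \<tau>\<bar>"]
      by (auto simp: abs_mult mult_ac split: if_splits)
  qed
  also have "\<dots> = (2 * real k + 1) * B * rem_part S f \<sigma>"
    unfolding rem_part_def sum_distrib_left by (simp add: sum.inter_filter)
  finally have "\<bar>\<Sum>\<tau>\<in>perms. f \<tau> * cyl_kernel k S \<sigma> \<tau>\<bar> \<le> B * lin_part S f \<sigma> + (2 * real k + 1) * B * rem_part S f \<sigma>"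
    using eq 1 by linarith
  then show ?thesis by (simp add: B_def algebra_simps)
qed

text \<open>Cauchy--Schwarz over the pairs (i, i') costs k^2. For uniform \<sigma> the value
  \<sigma> i' is uniform, so each pair yields (n-1)! times row i of the energy; k pairs share i, and
  i lies in (n-1 choose k-1) sets S.\<close>

lemma sum_lin_part_le:
  assumes k: "1 \<le> k"
  shows "(\<Sum>S\<in>subsets k. \<Sum>\<sigma>\<in>perms. (lin_part S f \<sigma>)\<^sup>2)
    \<le> real k ^ 3 * fact (card D - 1) * real ((card D - 1) choose (k - 1)) * energy f"
proof -
  define r where "r = (\<lambda>i. \<Sum>j\<in>D. (psum f i j)\<^sup>2)"
  have one: "(\<Sum>\<sigma>\<in>perms. (lin_part S f \<sigma>)\<^sup>2) \<le> real k ^ 3 * fact (card D - 1) * (\<Sum>i\<in>S. r i)"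
    if S: "S \<in> subsets k" for S
  proof -
    note SD = subsetsD[OF S]
    have "(lin_part S f \<sigma>)\<^sup>2 \<le> real k ^ 2 * (\<Sum>i\<in>S. \<Sum>i'\<in>S. (psum f i (\<sigma> i'))\<^sup>2)" for \<sigma>
      using square_sum_le_card[of "\<lambda>x. \<bar>psum f (fst x) (\<sigma> (snd x))\<bar>" "S \<times> S"] SD
      by (simp add: lin_part_def sum.cartesian_product case_prod_unfold card_cartesian_product power2_eq_square)
    then have "(\<Sum>\<sigma>\<in>perms. (lin_part S f \<sigma>)\<^sup>2)
        \<le> (\<Sum>\<sigma>\<in>perms. real k ^ 2 * (\<Sum>i\<in>S. \<Sum>i'\<in>S. (psum f i (\<sigma> i'))\<^sup>2))"
      by (intro sum_mono)
    also have "\<dots> = real k ^ 2 * (\<Sum>i\<in>S. \<Sum>i'\<in>S. \<Sum>\<sigma>\<in>perms. (psum f i (\<sigma> i'))\<^sup>2)"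
      unfolding sum_distrib_left[symmetric]
      by (subst sum.swap) (intro arg_cong2[where f = "(*)"] refl sum.cong sum.swap)
    also have "\<dots> = real k ^ 2 * (\<Sum>i\<in>S. \<Sum>i'\<in>S. fact (card D - 1) * r i)"
      unfolding r_def using SD by (intro arg_cong2[where f = "(*)"] refl sum.cong sum_perms_point) auto
    also have "\<dots> = real k ^ 3 * fact (card D - 1) * (\<Sum>i\<in>S. r i)"
      using SD by (simp add: sum_distrib_left sum_distrib_right power2_eq_square power3_eq_cube mult_ac)
    finally show ?thesis .
  qed
  have "(\<Sum>S\<in>subsets k. \<Sum>i\<in>S. r i) = (\<Sum>S\<in>subsets k. \<Sum>i\<in>D. if i \<in> S then r i else 0)"
    by (rule sum.cong[OF refl]) (simp add: sum.If_cases Int_absorb1 subsetsD(1))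
  also have "\<dots> = (\<Sum>i\<in>D. \<Sum>S\<in>subsets k. if i \<in> S then r i else 0)"
    by (rule sum.swap)
  also have "\<dots> = (\<Sum>i\<in>D. real ((card D - 1) choose (k - 1)) * r i)"
    using card_subsets_containing[OF _ k] by (intro sum.cong refl) (simp add: sum.If_cases Int_def)
  also have "\<dots> = real ((card D - 1) choose (k - 1)) * energy f"
    by (simp add: energy_def r_def sum_distrib_left)
  finally have two: "(\<Sum>S\<in>subsets k. \<Sum>i\<in>S. r i) = real ((card D - 1) choose (k - 1)) * energy f" .
  have "(\<Sum>S\<in>subsets k. \<Sum>\<sigma>\<in>perms. (lin_part S f \<sigma>)\<^sup>2)
      \<le> (\<Sum>S\<in>subsets k. real k ^ 3 * fact (card D - 1) * (\<Sum>i\<in>S. r i))"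
    using one by (intro sum_mono)
  also have "\<dots> = real k ^ 3 * fact (card D - 1) * (\<Sum>S\<in>subsets k. \<Sum>i\<in>S. r i)"
    by (simp add: sum_distrib_left)
  finally show ?thesis unfolding two by (simp add: mult_ac)
qed

text \<open>Schur test for the symmetric 0-1 matrix \<open>overlap2 S\<close>: its row sums, hence
  also its column sums, are at most k^4 (n-2)!.\<close>

lemma sum_rem_part_le:
  "(\<Sum>S\<in>subsets k. \<Sum>\<sigma>\<in>perms. (rem_part S f \<sigma>)\<^sup>2)
    \<le> real (card D choose k) * ((real k ^ 4 * fact (card D - 2))\<^sup>2 * (\<Sum>\<sigma>\<in>perms. (f \<sigma>)\<^sup>2))"
proof -
  define b where "b = real k ^ 4 * fact (card D - 2)"
  have b0: "0 \<le> b" by (simp add: b_def)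
  have "(\<Sum>\<sigma>\<in>perms. (rem_part S f \<sigma>)\<^sup>2) \<le> b\<^sup>2 * (\<Sum>\<sigma>\<in>perms. (f \<sigma>)\<^sup>2)" if S: "S \<in> subsets k" for S
  proof -
    have card_le: "real (card {\<tau> \<in> perms. overlap2 S \<sigma> \<tau>}) \<le> b" if "\<sigma> \<in> perms" for \<sigma>
      using of_nat_mono[OF card_overlap2_le[OF S that], where 'a = real] by (simp add: b_def)
    have "(\<Sum>\<sigma>\<in>perms. (rem_part S f \<sigma>)\<^sup>2) \<le> (\<Sum>\<sigma>\<in>perms. b * (\<Sum>\<tau>\<in>perms. if overlap2 S \<sigma> \<tau> then (f \<tau>)\<^sup>2 else 0))"
    proof (rule sum_mono)
      fix \<sigma> assume s: "\<sigma> \<in> perms"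
      have "(rem_part S f \<sigma>)\<^sup>2 \<le> real (card {\<tau> \<in> perms. overlap2 S \<sigma> \<tau>}) * (\<Sum>\<tau>\<in>{\<tau> \<in> perms. overlap2 S \<sigma> \<tau>}. (f \<tau>)\<^sup>2)"
        unfolding rem_part_def using square_sum_le_card[of "\<lambda>\<tau>. \<bar>f \<tau>\<bar>" "{\<tau> \<in> perms. overlap2 S \<sigma> \<tau>}"] by simp
      also have "\<dots> \<le> b * (\<Sum>\<tau>\<in>{\<tau> \<in> perms. overlap2 S \<sigma> \<tau>}. (f \<tau>)\<^sup>2)"
        using card_le[OF s] by (intro mult_right_mono sum_nonneg) auto
      finally show "(rem_part S f \<sigma>)\<^sup>2 \<le> b * (\<Sum>\<tau>\<in>perms. if overlap2 S \<sigma> \<tau> then (f \<tau>)\<^sup>2 else 0)"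
        by (simp add: sum.inter_filter)
    qed
    also have "\<dots> = b * (\<Sum>\<sigma>\<in>perms. \<Sum>\<tau>\<in>perms. if overlap2 S \<sigma> \<tau> then (f \<tau>)\<^sup>2 else 0)"
      by (simp add: sum_distrib_left)
    also have "\<dots> = b * (\<Sum>\<tau>\<in>perms. \<Sum>\<sigma>\<in>perms. if overlap2 S \<sigma> \<tau> then (f \<tau>)\<^sup>2 else 0)"
      by (subst sum.swap) simp
    also have "\<dots> = b * (\<Sum>\<tau>\<in>perms. real (card {\<sigma> \<in> perms. overlap2 S \<tau> \<sigma>}) * (f \<tau>)\<^sup>2)"
      by (simp add: sum.If_cases Int_def overlap2_sym[of S _ ])
    also have "\<dots> \<le> b * (\<Sum>\<tau>\<in>perms. b * (f \<tau>)\<^sup>2)"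
      using card_le b0 by (intro mult_left_mono sum_mono mult_right_mono) auto
    finally show ?thesis by (simp add: sum_distrib_left power2_eq_square mult.assoc)
  qed
  then have "(\<Sum>S\<in>subsets k. \<Sum>\<sigma>\<in>perms. (rem_part S f \<sigma>)\<^sup>2) \<le> (\<Sum>S\<in>subsets k. b\<^sup>2 * (\<Sum>\<sigma>\<in>perms. (f \<sigma>)\<^sup>2))"
    by (rule sum_mono)
  then show ?thesis by (simp add: card_subsets b_def)
qed

text \<open>Pairing \<open>f\<close> with its image \<open>H\<close> under the form and applying Cauchy--Schwarz twice, one meets
  the sum of \<open>f\<close> against the kernel \<open>cyl_kernel\<close>, which is constant plus linear off the rare event
  of two coincidences.\<close>

lemma agree_form_cube_le:
  assumes k: "1 \<le> k" and n: "4 * k \<le> card D" and f0: "(\<Sum>\<tau>\<in>perms. f \<tau>) = 0"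
  defines "V \<equiv> \<Sum>\<sigma>\<in>perms. (f \<sigma>)\<^sup>2" and "\<nu> \<equiv> fact (card D - 1)"
  shows "agree_form k f f ^ 3 \<le> sieve_const k * V\<^sup>2 * \<nu>\<^sup>2 * (energy f + \<nu> * V / real (card D))"
proof -
  define H where "H = (\<lambda>\<sigma>. \<Sum>\<tau>\<in>perms. f \<tau> * real (card (agree \<sigma> \<tau>) choose k))"
  define T where "T = agree_form k f f"
  define Z where "Z = (\<Sum>\<sigma>\<in>perms. (H \<sigma>)\<^sup>2)"
  define W where "W = agree_form k H H"
  define c where "c = (fact (card D - k) :: real)"
  define B where "B = 4 ^ k * c"
  define q where "q = (2 * real k + 1)\<^sup>2"
  define R where "R = energy f"
  have c0: "0 < c" by (simp add: c_def)
  have V0: "0 \<le> V" by (simp add: V_def sum_nonneg)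
  have R0: "0 \<le> R" by (simp add: R_def energy_def sum_nonneg)
  have T0: "0 \<le> T" by (simp add: T_def agree_form_nonneg)
  have \<nu>0: "0 < \<nu>" by (simp add: \<nu>_def)
  \<comment> \<open>T pairs f with its image H, Z is the squared norm of H, and W is the form at H.
    The two Cauchy--Schwarz steps give T^2 \<le> V Z and Z^2 \<le> W T, so that only W has to be
    estimated.\<close>
  have "T = (\<Sum>\<sigma>\<in>perms. f \<sigma> * H \<sigma>)"
    by (simp add: T_def agree_form_def H_def sum_distrib_left mult.assoc)
  then have TZ: "T\<^sup>2 \<le> V * Z"
    using Cauchy_Schwarz_ineq_sum[of f H perms] by (simp add: V_def Z_def)
  have "Z = agree_form k H f"
    by (simp add: Z_def agree_form_def power2_eq_square sum_distrib_left mult.assoc flip: H_def)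
      (simp add: H_def sum_distrib_left mult.assoc)
  then have ZW: "Z\<^sup>2 \<le> W * T"
    using agree_form_Cauchy_Schwarz[of k H f] by (simp add: W_def T_def)
  have cs: "csum S H \<sigma> = (\<Sum>\<tau>\<in>perms. f \<tau> * cyl_kernel k S \<sigma> \<tau>)" for S \<sigma>
    unfolding csum_def H_def cyl_kernel_def sum_distrib_left by (rule sum.swap)
  have sq: "(csum S H \<sigma>)\<^sup>2 \<le> 2 * B\<^sup>2 * ((lin_part S f \<sigma>)\<^sup>2 + q * (rem_part S f \<sigma>)\<^sup>2)"
    if "S \<in> subsets k" "\<sigma> \<in> perms" for S \<sigma>
  proof -
    define x where "x = lin_part S f \<sigma>"
    define y where "y = (2 * real k + 1) * rem_part S f \<sigma>"
    have "\<bar>csum S H \<sigma>\<bar> \<le> B * (x + y)"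
      unfolding cs x_def y_def B_def c_def by (rule cyl_kernel_sum_le[OF k n that f0])
    then have "(csum S H \<sigma>)\<^sup>2 \<le> (B * (x + y))\<^sup>2"
      by (metis abs_ge_zero power2_abs power_mono)
    also have "\<dots> \<le> B\<^sup>2 * (2 * (x\<^sup>2 + y\<^sup>2))"
      unfolding power_mult_distrib
      by (intro mult_left_mono) (use sum_squares_bound[of x y] in \<open>auto simp: power2_sum\<close>)
    also have "y\<^sup>2 = q * (rem_part S f \<sigma>)\<^sup>2" by (simp add: y_def q_def power_mult_distrib)
    finally show ?thesis by (simp add: x_def algebra_simps)
  qed
  have "c * W = (\<Sum>S\<in>subsets k. \<Sum>\<sigma>\<in>perms. (csum S H \<sigma>)\<^sup>2)"
    by (simp add: c_def W_def fact_agree_form_self)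
  also have "\<dots> \<le> (\<Sum>S\<in>subsets k. \<Sum>\<sigma>\<in>perms. 2 * B\<^sup>2 * ((lin_part S f \<sigma>)\<^sup>2 + q * (rem_part S f \<sigma>)\<^sup>2))"
    using sq by (intro sum_mono)
  also have "\<dots> = 2 * B\<^sup>2 * ((\<Sum>S\<in>subsets k. \<Sum>\<sigma>\<in>perms. (lin_part S f \<sigma>)\<^sup>2)
      + q * (\<Sum>S\<in>subsets k. \<Sum>\<sigma>\<in>perms. (rem_part S f \<sigma>)\<^sup>2))"
    by (simp add: sum.distrib flip: sum_distrib_left)
  also have "\<dots> \<le> 2 * B\<^sup>2 * (real k ^ 3 * \<nu> * real ((card D - 1) choose (k - 1)) * R
      + q * (real (card D choose k) * ((real k ^ 4 * fact (card D - 2))\<^sup>2 * V)))"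
    unfolding \<nu>_def R_def V_def
    by (intro mult_left_mono add_mono sum_lin_part_le[OF k] sum_rem_part_le) (auto simp: q_def)
  \<comment> \<open>B^2 contains c^2: one factor c is kept outside to cancel against the left side,
    the other turns the binomial coefficients into quotients of factorials.\<close>
  also have "\<dots> = c * (2 * 16 ^ k * (real k ^ 3 * \<nu> * (c * real ((card D - 1) choose (k - 1))) * R
      + q * real k ^ 8 * ((fact (card D - 2))\<^sup>2 * (c * real (card D choose k)) * V)))"
  proof -
    have "B\<^sup>2 = 16 ^ k * c * c"
      by (simp add: B_def power2_eq_square power_mult_distrib[symmetric] mult_ac)
    moreover have "(real k ^ 4 * fact (card D - 2))\<^sup>2 = real k ^ 8 * (fact (card D - 2))\<^sup>2"
      by (simp add: power_mult_distrib flip: power_mult)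
    ultimately show ?thesis by (simp add: algebra_simps)
  qed
  finally have "W \<le> 2 * 16 ^ k * (real k ^ 3 * \<nu> * (c * real ((card D - 1) choose (k - 1))) * R
      + q * real k ^ 8 * ((fact (card D - 2))\<^sup>2 * (c * real (card D choose k)) * V))"
    using c0 by (simp only: mult_le_cancel_left_pos)
  also have "\<dots> \<le> 2 * 16 ^ k * (real k ^ 3 * \<nu> * \<nu> * R + q * real k ^ 8 * ((fact (card D - 2))\<^sup>2 * fact (card D) * V))"
  proof -
    have "c * real ((card D - 1) choose (k - 1)) \<le> \<nu>"
      using fact_mult_choose_le[of "k - 1" "card D - 1"] k n by (simp add: c_def \<nu>_def)
    moreover have "c * real (card D choose k) \<le> fact (card D)"
      using fact_mult_choose_le[of k "card D"] n by (simp add: c_def)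
    ultimately show ?thesis using V0 R0 \<nu>0 c0
      by (intro mult_left_mono add_mono mult_right_mono) (auto simp: q_def)
  qed
  also have "\<dots> \<le> 2 * 16 ^ k * (4 * q * real k ^ 8 * \<nu> * \<nu> * R + q * real k ^ 8 * (4 * \<nu> ^ 3 / real (card D) * V))"
  proof -
    have "real k ^ 3 \<le> real k ^ 8" using k by (intro power_increasing) auto
    also have "\<dots> \<le> 4 * q * real k ^ 8"
    proof -
      have "1 \<le> q" unfolding q_def by (intro one_le_power) simp
      then show ?thesis using mult_right_mono[of 1 "4 * q" "real k ^ 8"] by simp
    qed
    finally show ?thesis using fact_diff_two_square_le[of "card D"] V0 R0 \<nu>0 k n
      by (intro mult_left_mono add_mono mult_right_mono) (auto simp: q_def \<nu>_def)
  qed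
  \<comment> \<open>Origin of \<open>sieve_const\<close>: 8 is the 2 of (x+y)^2 \<le> 2 (x^2+y^2)
    times the 4 of \<open>fact_diff_two_square_le\<close>, 16^k comes from B^2, and the linear term
    was weakened from k^3 to 4 q k^8 so that both terms share one constant.\<close>
  also have "\<dots> = sieve_const k * \<nu>\<^sup>2 * (R + \<nu> * V / real (card D))"
    unfolding sieve_const_def q_def[symmetric]
    by (simp add: power2_eq_square[of \<nu>] power3_eq_cube algebra_simps)
  finally have W: "W \<le> sieve_const k * \<nu>\<^sup>2 * (R + \<nu> * V / real (card D))" .
  \<comment> \<open>T^4 \<le> V^2 Z^2 \<le> V^2 W T, after which one factor T cancels unless T =
    0.\<close>
  have "T ^ 3 * T = (T\<^sup>2)\<^sup>2" by (simp add: power2_eq_square power3_eq_cube)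
  also have "\<dots> \<le> (V * Z)\<^sup>2" using TZ by (intro power_mono) auto
  also have "\<dots> \<le> V\<^sup>2 * (W * T)" unfolding power_mult_distrib using ZW by (intro mult_left_mono) auto
  also have "\<dots> \<le> V\<^sup>2 * (sieve_const k * \<nu>\<^sup>2 * (R + \<nu> * V / real (card D)) * T)"
    using W T0 by (intro mult_left_mono mult_right_mono) auto
  finally have *: "T ^ 3 * T \<le> (sieve_const k * V\<^sup>2 * \<nu>\<^sup>2 * (R + \<nu> * V / real (card D))) * T"
    by (simp add: mult_ac)
  show ?thesis
  proof (cases "T = 0")
    case True
    have "0 \<le> sieve_const k * V\<^sup>2 * \<nu>\<^sup>2 * (R + \<nu> * V / real (card D))"
      using V0 R0 \<nu>0 by (simp add: sieve_const_def)
    then show ?thesis using True by (simp add: T_def R_def)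
  next
    case False
    then have "0 < T" using T0 by simp
    then show ?thesis using * by (simp add: T_def R_def)
  qed
qed

subsection \<open>Fourth moments of permutation statistics\<close>

lemma sum_perms_transpose:
  fixes h :: "('a \<Rightarrow> 'a) \<Rightarrow> real"
  assumes "k \<in> D" "l \<in> D"
  shows "(\<Sum>\<sigma>\<in>perms. h (\<sigma> \<circ> transpose k l)) = (\<Sum>\<sigma>\<in>perms. h \<sigma>)"
proof (rule sum.reindex_bij_witness[where i = "\<lambda>\<sigma>. \<sigma> \<circ> transpose k l" and j = "\<lambda>\<sigma>. \<sigma> \<circ> transpose k l"])
  show "\<sigma> \<circ> transpose k l \<in> perms" if "\<sigma> \<in> perms" for \<sigma>
    using that assms permutes_compose[OF permutes_swap_id] by (auto simp: perms_def)
  then show "\<sigma> \<circ> transpose k l \<in> perms" if "\<sigma> \<in> perms" for \<sigma> using that by blast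
qed (auto simp: comp_assoc)

lemma sum_apply_perm: "\<sigma> \<in> perms \<Longrightarrow> (\<Sum>l\<in>D. h (\<sigma> l)) = (\<Sum>j\<in>D. h j)" for h :: "'a \<Rightarrow> real"
  using sum.permute[of \<sigma> D h] by (simp add: perms_def comp_def)

text \<open>The pair \<open>\<sigma>\<close>, \<open>\<sigma> \<circ> (k l)\<close> is exchangeable, which converts the fourth moment of a
  permutation statistic into its second moment against the squared increments (Stein's method).\<close>

lemma sum_fourth_power_le:
  fixes y :: "'a \<Rightarrow> 'a \<Rightarrow> real"
  assumes rows: "\<And>i. i \<in> D \<Longrightarrow> (\<Sum>j\<in>D. y i j) = 0"
    and M: "\<And>i j. i \<in> D \<Longrightarrow> j \<in> D \<Longrightarrow> \<bar>y i j\<bar> \<le> M" and n: "2 \<le> card D"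
  defines "Y \<equiv> \<Sum>i\<in>D. \<Sum>j\<in>D. (y i j)\<^sup>2"
  shows "(\<Sum>\<sigma>\<in>perms. (\<Sum>i\<in>D. y i (\<sigma> i)) ^ 4)
    \<le> 72 * (fact (card D - 1) * M\<^sup>2 * Y + 2 * fact (card D - 2) * Y\<^sup>2)"
proof -
  define G where "G = (\<lambda>\<sigma>. \<Sum>i\<in>D. y i (\<sigma> i))"
  define V where "V = (\<lambda>\<sigma>. \<Sum>i\<in>D. (y i (\<sigma> i))\<^sup>2)"
  define \<Delta> where "\<Delta> = (\<lambda>k l \<sigma>. y k (\<sigma> k) + y l (\<sigma> l) - y k (\<sigma> l) - y l (\<sigma> k))"
  define r where "r = (\<lambda>i. \<Sum>j\<in>D. (y i j)\<^sup>2)"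
  have r0: "0 \<le> r i" for i by (simp add: r_def sum_nonneg)
  have Y: "Y = (\<Sum>i\<in>D. r i)" by (simp add: Y_def r_def)
  have Y0: "0 \<le> Y" using r0 by (simp add: Y sum_nonneg)
  have n0: "0 < real (card D)" "D \<noteq> {}" using n by auto
  have G': "G \<sigma> - G (\<sigma> \<circ> transpose k l) = \<Delta> k l \<sigma>" if "k \<in> D" "l \<in> D" for k l \<sigma>
  proof (cases "k = l")
    case True
    then show ?thesis by (simp add: \<Delta>_def)
  next
    case False
    have "G \<sigma> - G (\<sigma> \<circ> transpose k l) = (\<Sum>i\<in>D. y i (\<sigma> i) - y i (\<sigma> (transpose k l i)))"
      by (simp add: G_def sum_subtractf)
    also have "\<dots> = (\<Sum>i\<in>{k, l}. y i (\<sigma> i) - y i (\<sigma> (transpose k l i)))"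
      using that by (intro sum.mono_neutral_right) auto
    also have "\<dots> = \<Delta> k l \<sigma>" using False by (simp add: \<Delta>_def)
    finally show ?thesis .
  qed
  have cross: "(\<Sum>k\<in>D. \<Sum>l\<in>D. y k (\<sigma> l)) = 0" if "\<sigma> \<in> perms" for \<sigma>
    using rows sum_apply_perm[OF that] by (simp add: sum.neutral)
  \<comment> \<open>Vanishing row sums kill the mixed terms, so the increments over all pairs add up
    to a multiple of G itself: the regression property of the exchangeable pair.\<close>
  have sumD: "(\<Sum>k\<in>D. \<Sum>l\<in>D. \<Delta> k l \<sigma>) = 2 * card D * G \<sigma>" if "\<sigma> \<in> perms" for \<sigma>
  proof -
    have "(\<Sum>k\<in>D. \<Sum>l\<in>D. y l (\<sigma> k)) = 0"
      using cross[OF that] by (subst sum.swap) simp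
    then show ?thesis using cross[OF that]
      by (simp add: \<Delta>_def sum.distrib sum_subtractf G_def flip: sum_distrib_left)
  qed
  have sumD2: "(\<Sum>k\<in>D. \<Sum>l\<in>D. (\<Delta> k l \<sigma>)\<^sup>2) \<le> 8 * (card D * V \<sigma> + Y)" if "\<sigma> \<in> perms" for \<sigma>
  proof -
    have sq: "(a + b - c - d)\<^sup>2 \<le> 4 * (a\<^sup>2 + b\<^sup>2 + c\<^sup>2 + d\<^sup>2)" for a b c d :: real
    proof -
      have e: "4 * (a\<^sup>2 + b\<^sup>2 + c\<^sup>2 + d\<^sup>2) - (a + b - c - d)\<^sup>2
          = (a - b)\<^sup>2 + (a + c)\<^sup>2 + (a + d)\<^sup>2 + (b + c)\<^sup>2 + (b + d)\<^sup>2 + (c - d)\<^sup>2"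
        by (simp add: power2_eq_square algebra_simps)
      have "0 \<le> (a - b)\<^sup>2 + (a + c)\<^sup>2 + (a + d)\<^sup>2 + (b + c)\<^sup>2 + (b + d)\<^sup>2 + (c - d)\<^sup>2" by simp
      then show ?thesis unfolding e[symmetric] by (simp only: diff_ge_0_iff_ge)
    qed
    have c: "(\<Sum>k\<in>D. \<Sum>l\<in>D. (y k (\<sigma> l))\<^sup>2) = Y"
      unfolding Y_def by (rule sum.cong[OF refl]) (rule sum_apply_perm[OF that])
    have c': "(\<Sum>k\<in>D. \<Sum>l\<in>D. (y l (\<sigma> k))\<^sup>2) = Y" using c by (subst sum.swap) simp
    have "(\<Sum>k\<in>D. \<Sum>l\<in>D. (\<Delta> k l \<sigma>)\<^sup>2)
        \<le> (\<Sum>k\<in>D. \<Sum>l\<in>D. 4 * ((y k (\<sigma> k))\<^sup>2 + (y l (\<sigma> l))\<^sup>2 + (y k (\<sigma> l))\<^sup>2 + (y l (\<sigma> k))\<^sup>2))"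
      unfolding \<Delta>_def by (intro sum_mono sq)
    also have "\<dots> = 8 * (card D * V \<sigma> + Y)"
      using c c' by (simp add: sum.distrib V_def flip: sum_distrib_left)
    finally show ?thesis .
  qed
  \<comment> \<open>With a and b the values of G before and after the transposition, symmetrising
    reduces the claim to (a^3-b^3)(a-b) \<le> 3/2 (a^2+b^2)(a-b)^2, where the difference of the
    sides is (a-b)^4/2.\<close>
  have pair: "(\<Sum>\<sigma>\<in>perms. G \<sigma> ^ 3 * \<Delta> k l \<sigma>) \<le> 3 / 2 * (\<Sum>\<sigma>\<in>perms. (G \<sigma>)\<^sup>2 * (\<Delta> k l \<sigma>)\<^sup>2)"
    if kl: "k \<in> D" "l \<in> D" for k l
  proof -
    define G1 where "G1 = (\<lambda>\<sigma>. G (\<sigma> \<circ> transpose k l))"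
    have inv: "G1 (\<sigma> \<circ> transpose k l) = G \<sigma>" for \<sigma> by (simp add: G1_def comp_assoc)
    have d: "\<Delta> k l \<sigma> = G \<sigma> - G1 \<sigma>" for \<sigma> using G'[OF kl] by (simp add: G1_def)
    have e1: "(\<Sum>\<sigma>\<in>perms. G \<sigma> ^ 3 * (G \<sigma> - G1 \<sigma>)) = (\<Sum>\<sigma>\<in>perms. G1 \<sigma> ^ 3 * (G1 \<sigma> - G \<sigma>))"
      using sum_perms_transpose[OF kl, of "\<lambda>\<sigma>. G \<sigma> ^ 3 * (G \<sigma> - G1 \<sigma>)"] unfolding inv
      by (simp add: G1_def)
    have e2: "(\<Sum>\<sigma>\<in>perms. (G \<sigma>)\<^sup>2 * (G \<sigma> - G1 \<sigma>)\<^sup>2) = (\<Sum>\<sigma>\<in>perms. (G1 \<sigma>)\<^sup>2 * (G \<sigma> - G1 \<sigma>)\<^sup>2)"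
      using sum_perms_transpose[OF kl, of "\<lambda>\<sigma>. (G \<sigma>)\<^sup>2 * (G \<sigma> - G1 \<sigma>)\<^sup>2"] unfolding inv
      by (simp add: G1_def power2_commute)
    have alg: "a ^ 3 * (a - b) + b ^ 3 * (b - a) \<le> 3 / 2 * (a\<^sup>2 * (a - b)\<^sup>2 + b\<^sup>2 * (a - b)\<^sup>2)" for a b :: real
    proof -
      have e: "3 / 2 * (a\<^sup>2 * (a - b)\<^sup>2 + b\<^sup>2 * (a - b)\<^sup>2) - (a ^ 3 * (a - b) + b ^ 3 * (b - a))
          = 1 / 2 * ((a - b)\<^sup>2)\<^sup>2"
        by (simp add: power2_eq_square power3_eq_cube algebra_simps)
      have "0 \<le> 1 / 2 * ((a - b)\<^sup>2)\<^sup>2" by simp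
      then show ?thesis unfolding e[symmetric] by (simp only: diff_ge_0_iff_ge)
    qed
    have "2 * (\<Sum>\<sigma>\<in>perms. G \<sigma> ^ 3 * (G \<sigma> - G1 \<sigma>))
        = (\<Sum>\<sigma>\<in>perms. G \<sigma> ^ 3 * (G \<sigma> - G1 \<sigma>) + G1 \<sigma> ^ 3 * (G1 \<sigma> - G \<sigma>))"
      using e1 by (simp add: sum.distrib)
    also have "\<dots> \<le> (\<Sum>\<sigma>\<in>perms. 3 / 2 * ((G \<sigma>)\<^sup>2 * (G \<sigma> - G1 \<sigma>)\<^sup>2 + (G1 \<sigma>)\<^sup>2 * (G \<sigma> - G1 \<sigma>)\<^sup>2))"
      by (intro sum_mono alg)
    also have "\<dots> = 3 * (\<Sum>\<sigma>\<in>perms. (G \<sigma>)\<^sup>2 * (G \<sigma> - G1 \<sigma>)\<^sup>2)"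
      unfolding sum_distrib_left[symmetric] sum.distrib e2[symmetric] by simp
    finally show ?thesis unfolding d by simp
  qed
  have swap: "(\<Sum>\<sigma>\<in>perms. \<Sum>k\<in>D. \<Sum>l\<in>D. h \<sigma> k l) = (\<Sum>k\<in>D. \<Sum>l\<in>D. \<Sum>\<sigma>\<in>perms. h \<sigma> k l)"
    for h :: "('a \<Rightarrow> 'a) \<Rightarrow> 'a \<Rightarrow> 'a \<Rightarrow> real"
    by (subst sum.swap) (intro sum.cong refl sum.swap)
  have "2 * card D * (\<Sum>\<sigma>\<in>perms. G \<sigma> ^ 4) = (\<Sum>\<sigma>\<in>perms. G \<sigma> ^ 3 * (\<Sum>k\<in>D. \<Sum>l\<in>D. \<Delta> k l \<sigma>))"
    unfolding sum_distrib_left[of _ _ perms]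
    by (intro sum.cong refl) (simp add: sumD power4_eq_xxxx power3_eq_cube)
  also have "\<dots> = (\<Sum>k\<in>D. \<Sum>l\<in>D. \<Sum>\<sigma>\<in>perms. G \<sigma> ^ 3 * \<Delta> k l \<sigma>)"
    unfolding sum_distrib_left by (rule swap)
  also have "\<dots> \<le> (\<Sum>k\<in>D. \<Sum>l\<in>D. 3 / 2 * (\<Sum>\<sigma>\<in>perms. (G \<sigma>)\<^sup>2 * (\<Delta> k l \<sigma>)\<^sup>2))"
    by (intro sum_mono pair)
  also have "\<dots> = 3 / 2 * (\<Sum>k\<in>D. \<Sum>l\<in>D. \<Sum>\<sigma>\<in>perms. (G \<sigma>)\<^sup>2 * (\<Delta> k l \<sigma>)\<^sup>2)"
    by (simp only: sum_distrib_left)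
  also have "(\<Sum>k\<in>D. \<Sum>l\<in>D. \<Sum>\<sigma>\<in>perms. (G \<sigma>)\<^sup>2 * (\<Delta> k l \<sigma>)\<^sup>2)
      = (\<Sum>\<sigma>\<in>perms. (G \<sigma>)\<^sup>2 * (\<Sum>k\<in>D. \<Sum>l\<in>D. (\<Delta> k l \<sigma>)\<^sup>2))"
    unfolding sum_distrib_left by (rule swap[symmetric])
  also have "3 / 2 * \<dots> \<le> 3 / 2 * (\<Sum>\<sigma>\<in>perms. (G \<sigma>)\<^sup>2 * (8 * (card D * V \<sigma> + Y)))"
    using sumD2 by (intro mult_left_mono sum_mono) auto
  also have "\<dots> = 2 * card D * (\<Sum>\<sigma>\<in>perms. 6 * (G \<sigma>)\<^sup>2 * (V \<sigma> + Y / card D))"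
    unfolding sum_distrib_left using n0 by (intro sum.cong refl) (simp add: field_simps)
  finally have "(\<Sum>\<sigma>\<in>perms. G \<sigma> ^ 4) \<le> (\<Sum>\<sigma>\<in>perms. 6 * (G \<sigma>)\<^sup>2 * (V \<sigma> + Y / card D))"
    by (rule mult_left_le_imp_le) (use n0(1) in simp)
  \<comment> \<open>The weights leave only half of the fourth moment on the right, to be absorbed on
    the left.\<close>
  also have "\<dots> \<le> (\<Sum>\<sigma>\<in>perms. G \<sigma> ^ 4 / 2 + 36 * (V \<sigma>)\<^sup>2 + 36 * (Y / card D)\<^sup>2)"
  proof (rule sum_mono)
    fix \<sigma>
    have "6 * a * (b + c) \<le> a\<^sup>2 / 2 + 36 * b\<^sup>2 + 36 * c\<^sup>2" for a b c :: real
    proof -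
      have e: "a\<^sup>2 / 2 + 36 * b\<^sup>2 + 36 * c\<^sup>2 - 6 * a * (b + c) = (a - 6 * (b + c))\<^sup>2 / 2 + 18 * (b - c)\<^sup>2"
        by (simp add: power2_eq_square field_simps)
      have "0 \<le> (a - 6 * (b + c))\<^sup>2 / 2 + 18 * (b - c)\<^sup>2" by simp
      then show ?thesis unfolding e[symmetric] by (simp only: diff_ge_0_iff_ge)
    qed
    from this[of "(G \<sigma>)\<^sup>2" "V \<sigma>" "Y / card D"]
    show "6 * (G \<sigma>)\<^sup>2 * (V \<sigma> + Y / card D) \<le> G \<sigma> ^ 4 / 2 + 36 * (V \<sigma>)\<^sup>2 + 36 * (Y / card D)\<^sup>2"
      by (simp flip: power_mult)
  qed
  also have "\<dots> = (\<Sum>\<sigma>\<in>perms. G \<sigma> ^ 4) / 2 + 36 * (\<Sum>\<sigma>\<in>perms. (V \<sigma>)\<^sup>2) + 36 * (fact (card D) * (Y / card D)\<^sup>2)"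
    by (simp add: sum.distrib sum_divide_distrib card_perms flip: sum_distrib_left)
  finally have G4: "(\<Sum>\<sigma>\<in>perms. G \<sigma> ^ 4) \<le> 72 * (\<Sum>\<sigma>\<in>perms. (V \<sigma>)\<^sup>2) + 72 * (fact (card D) * (Y / card D)\<^sup>2)"
    by linarith
  have "(\<Sum>\<sigma>\<in>perms. (V \<sigma>)\<^sup>2) = (\<Sum>i\<in>D. \<Sum>k\<in>D. \<Sum>\<sigma>\<in>perms. (y i (\<sigma> i))\<^sup>2 * (y k (\<sigma> k))\<^sup>2)"
    unfolding V_def power2_eq_square[of "sum _ _"] sum_product by (rule swap)
  \<comment> \<open>The diagonal of the square of V is where the sup bound M enters; off the
    diagonal the two values nearly decouple.\<close>
  also have "\<dots> \<le> (\<Sum>i\<in>D. \<Sum>k\<in>D. (if k = i then fact (card D - 1) * (M\<^sup>2 * r i) else 0) + fact (card D - 2) * (r i * r k))"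
  proof (intro sum_mono)
    fix i k assume ik: "i \<in> D" "k \<in> D"
    show "(\<Sum>\<sigma>\<in>perms. (y i (\<sigma> i))\<^sup>2 * (y k (\<sigma> k))\<^sup>2)
        \<le> (if k = i then fact (card D - 1) * (M\<^sup>2 * r i) else 0) + fact (card D - 2) * (r i * r k)"
    proof (cases "k = i")
      case True
      have "(\<Sum>\<sigma>\<in>perms. (y i (\<sigma> i))\<^sup>2 * (y k (\<sigma> k))\<^sup>2) = fact (card D - 1) * (\<Sum>j\<in>D. (y i j)\<^sup>2 * (y i j)\<^sup>2)"
        using sum_perms_point[OF ik(1), of "\<lambda>j. (y i j)\<^sup>2 * (y i j)\<^sup>2"] True by simp
      also have "\<dots> \<le> fact (card D - 1) * (\<Sum>j\<in>D. M\<^sup>2 * (y i j)\<^sup>2)"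
        using M[OF ik(1)] by (intro mult_left_mono sum_mono mult_right_mono)
          (auto simp: abs_le_square_iff[symmetric] intro: order_trans[OF _ abs_ge_self])
      also have "\<dots> = fact (card D - 1) * (M\<^sup>2 * r i)" by (simp add: r_def sum_distrib_left)
      finally show ?thesis using True r0 by (simp add: add_increasing2)
    next
      case False
      then show ?thesis unfolding r_def
        using sum_perms_two_points_le[OF ik, of "\<lambda>j. (y i j)\<^sup>2" "\<lambda>j. (y k j)\<^sup>2"] by simp
    qed
  qed
  also have "\<dots> = fact (card D - 1) * M\<^sup>2 * Y + fact (card D - 2) * Y\<^sup>2"
    by (simp add: sum.distrib Y power2_eq_square sum_product sum_distrib_left sum_distrib_right mult_ac)
  finally have V2: "(\<Sum>\<sigma>\<in>perms. (V \<sigma>)\<^sup>2) \<le> fact (card D - 1) * M\<^sup>2 * Y + fact (card D - 2) * Y\<^sup>2" .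
  have "fact (card D) * (Y / card D)\<^sup>2 \<le> fact (card D - 2) * Y\<^sup>2"
  proof -
    have nf: "fact (card D) = real (card D) * (real (card D - 1) * fact (card D - 2))"
      using n fact_reduce[of "card D", where 'a = real] fact_reduce[of "card D - 1", where 'a = real]
      by (simp add: numeral_2_eq_2)
    have "fact (card D) * (Y / card D)\<^sup>2 = (real (card D - 1) / card D) * (fact (card D - 2) * Y\<^sup>2)"
      unfolding nf using n0 by (simp add: power2_eq_square field_simps)
    also have "\<dots> \<le> 1 * (fact (card D - 2) * Y\<^sup>2)"
      using n0 by (intro mult_right_mono) (auto simp: field_simps)
    finally show ?thesis by simp
  qed
  then show ?thesis using G4 V2 unfolding G_def by (simp add: algebra_simps)
qed

subsection \<open>Cross-intersecting families\<close>

definition cross :: "('a \<Rightarrow> 'a) set \<Rightarrow> ('a \<Rightarrow> 'a) set \<Rightarrow> bool" where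
  "cross A B \<longleftrightarrow> (\<forall>\<sigma>\<in>A. \<forall>\<tau>\<in>B. \<exists>i\<in>D. \<sigma> i = \<tau> i)"

definition cind :: "('a \<Rightarrow> 'a) set \<Rightarrow> ('a \<Rightarrow> 'a) \<Rightarrow> real" where
  "cind A \<sigma> = (if \<sigma> \<in> A then 1 else 0) - real (card A) / fact (card D)"

lemma cross_sym: "cross A B \<Longrightarrow> cross B A"
  unfolding cross_def by metis

lemma sum_ind_mult:
  fixes h :: "('a \<Rightarrow> 'a) \<Rightarrow> real"
  assumes "A \<subseteq> perms"
  shows "(\<Sum>\<sigma>\<in>perms. (if \<sigma> \<in> A then 1 else 0) * h \<sigma>) = (\<Sum>\<sigma>\<in>A. h \<sigma>)"
proof -
  have "(\<Sum>\<sigma>\<in>A. h \<sigma>) = (\<Sum>\<sigma>\<in>perms. if \<sigma> \<in> A then h \<sigma> else 0)"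
    using assms by (simp add: sum.If_cases Int_absorb1)
  also have "\<dots> = (\<Sum>\<sigma>\<in>perms. (if \<sigma> \<in> A then 1 else 0) * h \<sigma>)"
    by (rule sum.cong) auto
  finally show ?thesis by simp
qed

lemma sum_cind_mult:
  assumes "A \<subseteq> perms"
  shows "(\<Sum>\<sigma>\<in>perms. cind A \<sigma> * h \<sigma>) = (\<Sum>\<sigma>\<in>A. h \<sigma>) - real (card A) / fact (card D) * (\<Sum>\<sigma>\<in>perms. h \<sigma>)"
  unfolding cind_def left_diff_distrib sum_subtractf sum_ind_mult[OF assms]
  by (simp add: sum_distrib_left)

lemma sum_cind: "A \<subseteq> perms \<Longrightarrow> (\<Sum>\<sigma>\<in>perms. cind A \<sigma>) = 0"
  using sum_cind_mult[of A "\<lambda>_. 1"] by (simp add: card_perms)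

lemma sum_cind_square_le:
  assumes "A \<subseteq> perms"
  shows "(\<Sum>\<sigma>\<in>perms. (cind A \<sigma>)\<^sup>2) \<le> card A"
proof -
  have "(\<Sum>\<sigma>\<in>perms. (cind A \<sigma>)\<^sup>2) = (\<Sum>\<sigma>\<in>A. cind A \<sigma>)"
    using sum_cind_mult[OF assms, of "cind A"] sum_cind[OF assms] by (simp add: power2_eq_square)
  also have "\<dots> \<le> (\<Sum>\<sigma>\<in>A. 1)"
    by (intro sum_mono) (simp add: cind_def)
  finally show ?thesis by simp
qed

text \<open>The number of agreements with a fixed permutation has k-th binomial moment 1/k!: each of
  the (n choose k) position sets is matched by (n-k)! permutations.\<close>

lemma sum_agree_choose:
  assumes "\<sigma> \<in> perms" "k \<le> card D"
  shows "(\<Sum>\<tau>\<in>perms. real (card (agree \<sigma> \<tau>) choose k)) = fact (card D) / fact k"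
proof -
  have "(\<Sum>\<tau>\<in>perms. real (card (agree \<sigma> \<tau>) choose k))
      = (\<Sum>\<tau>\<in>perms. \<Sum>S\<in>subsets k. if \<forall>i\<in>S. \<tau> i = \<sigma> i then 1 else 0)"
    by (simp only: agree_sym[of \<sigma>] agree_choose_eq_sum)
  also have "\<dots> = (\<Sum>S\<in>subsets k. \<Sum>\<tau>\<in>perms. if \<forall>i\<in>S. \<tau> i = \<sigma> i then 1 else 0)"
    by (rule sum.swap)
  also have "\<dots> = (\<Sum>S\<in>subsets k. fact (card D - k))"
  proof (rule sum.cong[OF refl])
    fix S assume S: "S \<in> subsets k"
    show "(\<Sum>\<tau>\<in>perms. if \<forall>i\<in>S. \<tau> i = \<sigma> i then 1 else 0 :: real) = fact (card D - k)"
      using card_cyl[OF assms(1) S] by (simp add: sum.If_cases Int_def cyl_def)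
  qed
  also have "\<dots> = real (card D choose k) * fact (card D - k)" by (simp add: card_subsets)
  also have "\<dots> = fact (card D) / fact k"
    using binomial_fact[OF assms(2), where 'a = real] by simp
  finally show ?thesis .
qed

text \<open>The kernel has constant row and column sums n!/k!, so centring both indicators subtracts
  just the main term |A| |B| / k!.\<close>

lemma agree_form_cind:
  assumes A: "A \<subseteq> perms" and B: "B \<subseteq> perms" and k: "k \<le> card D"
  shows "agree_form k (cind A) (cind B)
    = (\<Sum>\<sigma>\<in>A. \<Sum>\<tau>\<in>B. real (card (agree \<sigma> \<tau>) choose k)) - real (card A) * real (card B) / fact k"
proof -
  define c where "c = (fact (card D) / fact k :: real)"
  define C where "C = (\<lambda>\<sigma> \<tau>. real (card (agree \<sigma> \<tau>) choose k))"
  define U where "U = (\<lambda>\<sigma>. (\<Sum>\<tau>\<in>B. C \<sigma> \<tau>) - real (card B) / fact (card D) * c)"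
  have row: "(\<Sum>\<tau>\<in>perms. C \<sigma> \<tau>) = c" if "\<sigma> \<in> perms" for \<sigma>
    unfolding C_def c_def by (rule sum_agree_choose[OF that k])
  have col: "(\<Sum>\<sigma>\<in>perms. C \<sigma> \<tau>) = c" if "\<tau> \<in> perms" for \<tau>
    using row[OF that] by (simp only: C_def agree_sym[of _ \<tau>])
  have "agree_form k (cind A) (cind B) = (\<Sum>\<sigma>\<in>perms. cind A \<sigma> * (\<Sum>\<tau>\<in>perms. cind B \<tau> * C \<sigma> \<tau>))"
    by (simp add: agree_form_def C_def sum_distrib_left mult.assoc)
  also have "\<dots> = (\<Sum>\<sigma>\<in>perms. cind A \<sigma> * U \<sigma>)"
    by (intro sum.cong refl) (simp add: sum_cind_mult[OF B] row U_def)
  also have "\<dots> = (\<Sum>\<sigma>\<in>A. U \<sigma>) - real (card A) / fact (card D) * (\<Sum>\<sigma>\<in>perms. U \<sigma>)"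
    by (rule sum_cind_mult[OF A])
  also have "(\<Sum>\<sigma>\<in>perms. U \<sigma>) = 0"
  proof -
    have "(\<Sum>\<sigma>\<in>perms. \<Sum>\<tau>\<in>B. C \<sigma> \<tau>) = (\<Sum>\<tau>\<in>B. \<Sum>\<sigma>\<in>perms. C \<sigma> \<tau>)"
      by (rule sum.swap)
    also have "\<dots> = (\<Sum>\<tau>\<in>B. c)"
      using B col by (intro sum.cong refl) auto
    also have "\<dots> = card B * c" by simp
    finally show ?thesis by (simp add: U_def sum_subtractf card_perms)
  qed
  finally show ?thesis by (simp add: U_def C_def c_def sum_subtractf)
qed

text \<open>\<open>one_add_choose_two_le\<close> summed over A \<times> B, where crossing supplies
  at least one agreement. The main terms leave 1 - 1 + 1/2 - 1/6 = 1/3; the shorter odd truncation 1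
  - X would leave 0.\<close>

lemma card_mult_card_le_agree_forms:
  assumes A: "A \<subseteq> perms" and B: "B \<subseteq> perms" and AB: "cross A B" and n: "3 \<le> card D"
  shows "real (card A) * real (card B) / 3 \<le> \<bar>agree_form 1 (cind A) (cind B)\<bar>
    + \<bar>agree_form 2 (cind A) (cind B)\<bar> + \<bar>agree_form 3 (cind A) (cind B)\<bar>"
proof -
  let ?N = "\<lambda>k. \<Sum>\<sigma>\<in>A. \<Sum>\<tau>\<in>B. real (card (agree \<sigma> \<tau>) choose k)"
  have "(\<Sum>\<sigma>\<in>A. \<Sum>\<tau>\<in>B. 1 + real (card (agree \<sigma> \<tau>) choose 2))
      \<le> (\<Sum>\<sigma>\<in>A. \<Sum>\<tau>\<in>B. real (card (agree \<sigma> \<tau>) choose 1) + real (card (agree \<sigma> \<tau>) choose 3))"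
  proof (intro sum_mono)
    fix \<sigma> \<tau> assume "\<sigma> \<in> A" "\<tau> \<in> B"
    then have "agree \<sigma> \<tau> \<noteq> {}" using AB by (auto simp: cross_def agree_def)
    then have "1 \<le> card (agree \<sigma> \<tau>)" by (simp add: Suc_le_eq card_gt_0_iff)
    from of_nat_mono[OF one_add_choose_two_le[OF this], where 'a = real]
    show "1 + real (card (agree \<sigma> \<tau>) choose 2)
        \<le> real (card (agree \<sigma> \<tau>) choose 1) + real (card (agree \<sigma> \<tau>) choose 3)" by simp
  qed
  then have "real (card A) * real (card B) + ?N 2 \<le> ?N 1 + ?N 3"
    by (simp add: sum.distrib)
  moreover have "?N 1 = agree_form 1 (cind A) (cind B) + real (card A) * real (card B)"
    "?N 2 = agree_form 2 (cind A) (cind B) + real (card A) * real (card B) / 2"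
    "?N 3 = agree_form 3 (cind A) (cind B) + real (card A) * real (card B) / 6"
    using agree_form_cind[OF A B, of 1] agree_form_cind[OF A B, of 2] agree_form_cind[OF A B, of 3] n
    by (auto simp: fact_numeral)
  ultimately show ?thesis by linarith
qed

text \<open>The last factor of \<open>agree_form_cube_le\<close> for \<open>cind A\<close>, with the
  squared norm replaced by its upper bound |A|.\<close>

definition total_energy :: "('a \<Rightarrow> 'a) set \<Rightarrow> real" where
  "total_energy A = energy (cind A) + fact (card D - 1) * real (card A) / real (card D)"

lemma energy_nonneg: "0 \<le> energy f"
  by (simp add: energy_def sum_nonneg)

lemma total_energy_nonneg: "0 \<le> total_energy A"
  by (simp add: total_energy_def energy_nonneg)

lemma divide_card_le: "0 \<le> x \<Longrightarrow> 1 \<le> card D \<Longrightarrow> x / real (card D) \<le> x"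
  using mult_left_mono[of 1 "real (card D)" x] by (auto simp: divide_le_eq)

text \<open>The sieve for the three needed orders at once: \<open>sieve_const\<close> is monotone,
  and 12 is 4 k at k = 3.\<close>

lemma agree_form_cind_cube_le:
  assumes A: "A \<subseteq> perms" and k: "1 \<le> k" "k \<le> 3" and n: "12 \<le> card D"
  shows "agree_form k (cind A) (cind A) ^ 3
    \<le> sieve_const 3 * (real (card A))\<^sup>2 * (fact (card D - 1))\<^sup>2 * total_energy A"
proof -
  let ?V = "\<Sum>\<sigma>\<in>perms. (cind A \<sigma>)\<^sup>2"
  have V: "0 \<le> ?V" "?V \<le> card A" using sum_cind_square_le[OF A] by (auto simp: sum_nonneg)
  have "agree_form k (cind A) (cind A) ^ 3
      \<le> sieve_const k * ?V\<^sup>2 * (fact (card D - 1))\<^sup>2 * (energy (cind A) + fact (card D - 1) * ?V / real (card D))"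
    using k n sum_cind[OF A] by (intro agree_form_cube_le) auto
  also have "\<dots> \<le> sieve_const 3 * (real (card A))\<^sup>2 * (fact (card D - 1))\<^sup>2 * total_energy A"
    unfolding total_energy_def using V k sieve_const_mono[of k 3] energy_nonneg[of "cind A"] sieve_const_ge_1
    by (intro mult_mono add_mono power_mono divide_right_mono order_refl)
      (auto intro!: add_nonneg_nonneg mult_nonneg_nonneg divide_nonneg_nonneg)
  finally show ?thesis .
qed

text \<open>For k = 1 the sieve bounds the energy x by itself: x^3 \<le> C m^2 (x + m/n) with m =
  (n-1)! |A| and C = \<open>sieve_const 3\<close>. For x > 2 C m the cubic left side would
  win.\<close>

lemma energy_cind_le:
  assumes A: "A \<subseteq> perms" and n: "12 \<le> card D"
  shows "energy (cind A) \<le> 2 * sieve_const 3 * (fact (card D - 1) * real (card A))"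
proof (rule ccontr)
  define C where "C = sieve_const 3"
  define m where "m = fact (card D - 1) * real (card A)"
  define x where "x = energy (cind A)"
  have C1: "1 \<le> C" unfolding C_def by (rule sieve_const_ge_1)
  have m0: "0 \<le> m" by (simp add: m_def)
  assume "\<not> energy (cind A) \<le> 2 * sieve_const 3 * (fact (card D - 1) * real (card A))"
  then have x: "2 * C * m < x" by (simp add: x_def C_def m_def)
  have mC: "m \<le> 2 * C * m" using C1 m0 mult_right_mono[of 1 "2 * C" m] by simp
  have x0: "0 < x" "m < x" using x mC m0 by linarith+
  have md: "m / real (card D) \<le> m" using n by (intro divide_card_le m0) simp
  have "x ^ 3 \<le> C * (real (card A))\<^sup>2 * (fact (card D - 1))\<^sup>2 * (x + m / real (card D))"
    using agree_form_cind_cube_le[OF A _ _ n, of 1]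
    by (simp add: agree_form_one[unfolded One_nat_def] x_def C_def m_def total_energy_def)
  also have "\<dots> = C * m\<^sup>2 * (x + m / real (card D))" by (simp add: m_def power_mult_distrib)
  also have "\<dots> \<le> C * m\<^sup>2 * (2 * x)"
    using C1 x0 md by (intro mult_left_mono) auto
  finally have "x\<^sup>2 * x \<le> 2 * C * m\<^sup>2 * x" by (simp add: power2_eq_square power3_eq_cube mult_ac)
  then have 1: "x\<^sup>2 \<le> 2 * C * m\<^sup>2" using x0 by simp
  have "(2 * C * m)\<^sup>2 < x\<^sup>2" using x C1 m0 by (intro power_strict_mono) auto
  moreover have "2 * C * m\<^sup>2 \<le> (2 * C * m)\<^sup>2"
    unfolding power_mult_distrib using C1 self_le_power[of "2 * C" 2] by (intro mult_right_mono) auto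
  ultimately show False using 1 by linarith
qed

lemma total_energy_le:
  assumes A: "A \<subseteq> perms" and n: "12 \<le> card D"
  shows "total_energy A \<le> energy_const * (fact (card D - 1) * real (card A))"
proof -
  have "fact (card D - 1) * real (card A) / real (card D) \<le> fact (card D - 1) * real (card A)"
    using n by (intro divide_card_le) auto
  then show ?thesis using energy_cind_le[OF A n] unfolding total_energy_def energy_const_def
    by (simp add: algebra_simps)
qed

text \<open>One of the three forms is at least |A| |B| / 9 in absolute value. Its sixth power makes
  Cauchy--Schwarz produce the cubes that the sieve bounds, and a factor (|A| |B|)^2 then
  cancels.\<close>

lemma cross_total_energy:
  assumes A: "A \<subseteq> perms" and B: "B \<subseteq> perms" and AB: "cross A B" and n: "12 \<le> card D"
  shows "(real (card A) * real (card B)) ^ 4 \<le> cross_const * fact (card D - 1) ^ 4 * (total_energy A * total_energy B)"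
proof (cases "card A * card B = 0")
  case True
  then have z: "(real (card A) * real (card B)) ^ 4 = 0" by auto
  show ?thesis unfolding z using cross_const_ge_1 by (intro mult_nonneg_nonneg total_energy_nonneg) auto
next
  case False
  define p where "p = real (card A) * real (card B)"
  define \<nu> where "\<nu> = (fact (card D - 1) :: real)"
  define C where "C = sieve_const 3"
  define E where "E = total_energy A * total_energy B"
  have p0: "0 < p" using False by (simp add: p_def)
  have "\<exists>k. 1 \<le> k \<and> k \<le> 3 \<and> p / 9 \<le> \<bar>agree_form k (cind A) (cind B)\<bar>"
  proof (rule ccontr)
    assume "\<not> ?thesis"
    then have "\<bar>agree_form k (cind A) (cind B)\<bar> < p / 9" if "1 \<le> k" "k \<le> 3" for k
      using that by (meson not_le)
    from this[of 1] this[of 2] this[of 3] show False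
      using card_mult_card_le_agree_forms[OF A B AB] n by (simp add: p_def)
  qed
  then obtain k where k: "1 \<le> k" "k \<le> 3" and b: "p / 9 \<le> \<bar>agree_form k (cind A) (cind B)\<bar>" by blast
  define S where "S = agree_form k (cind A) (cind A)"
  define T where "T = agree_form k (cind B) (cind B)"
  have S0: "0 \<le> S" and T0: "0 \<le> T" by (simp_all add: S_def T_def agree_form_nonneg)
  have "(p / 9) ^ 6 \<le> \<bar>agree_form k (cind A) (cind B)\<bar> ^ 6"
    using b p0 by (intro power_mono) auto
  also have "\<dots> = ((agree_form k (cind A) (cind B))\<^sup>2) ^ 3"
    by (simp flip: power_mult add: power_even_abs_numeral)
  also have "\<dots> \<le> (S * T) ^ 3"
    unfolding S_def T_def using agree_form_Cauchy_Schwarz by (intro power_mono) auto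
  also have "\<dots> = S ^ 3 * T ^ 3" by (rule power_mult_distrib)
  also have "\<dots> \<le> (C * (real (card A))\<^sup>2 * \<nu>\<^sup>2 * total_energy A) * (C * (real (card B))\<^sup>2 * \<nu>\<^sup>2 * total_energy B)"
    unfolding S_def T_def C_def \<nu>_def
    using agree_form_cind_cube_le[OF A k n] agree_form_cind_cube_le[OF B k n] T0 total_energy_nonneg[of A]
      sieve_const_ge_1
    by (intro mult_mono) (auto simp: T_def)
  also have "\<dots> = C\<^sup>2 * p\<^sup>2 * \<nu> ^ 4 * E"
    by (simp add: p_def E_def power2_eq_square power4_eq_xxxx)
  finally have "p\<^sup>2 * p ^ 4 \<le> p\<^sup>2 * (cross_const * \<nu> ^ 4 * E)"
    by (simp add: power_divide field_simps cross_const_def C_def flip: power_add)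
  then have "p ^ 4 \<le> cross_const * \<nu> ^ 4 * E"
    by (rule mult_left_le_imp_le) (use p0 in simp)
  then show ?thesis by (simp add: p_def \<nu>_def E_def)
qed

text \<open>With p = |A| |B|, inserting the upper bound for both total energies gives p^4 \<le> K
  (n-1)!^6 p.\<close>

lemma cross_card_le:
  assumes A: "A \<subseteq> perms" and B: "B \<subseteq> perms" and AB: "cross A B" and n: "12 \<le> card D"
  shows "real (card A) * real (card B) \<le> cross_const * energy_const\<^sup>2 * (fact (card D - 1))\<^sup>2"
proof (cases "card A * card B = 0")
  case True
  then have z: "real (card A) * real (card B) = 0" by auto
  show ?thesis unfolding z using cross_const_ge_1 by (intro mult_nonneg_nonneg) auto
next
  case False
  define p where "p = real (card A) * real (card B)"
  define \<nu> where "\<nu> = (fact (card D - 1) :: real)"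
  define K where "K = cross_const * energy_const\<^sup>2"
  have p0: "0 < p" using False by (simp add: p_def)
  have K1: "1 \<le> K" unfolding K_def
    using mult_mono[OF cross_const_ge_1 one_le_power[OF energy_const_ge_1, of 2]] cross_const_ge_1 by simp
  have "p ^ 4 \<le> cross_const * \<nu> ^ 4 * (total_energy A * total_energy B)"
    unfolding p_def \<nu>_def by (rule cross_total_energy[OF A B AB n])
  also have "\<dots> \<le> cross_const * \<nu> ^ 4 * ((energy_const * (\<nu> * real (card A))) * (energy_const * (\<nu> * real (card B))))"
    using total_energy_le[OF A n] total_energy_le[OF B n] total_energy_nonneg cross_const_ge_1 energy_const_ge_1
    by (intro mult_left_mono mult_mono) (auto simp: \<nu>_def)
  also have "\<dots> = K * \<nu> ^ 6 * p"
    by (simp add: K_def p_def power2_eq_square eval_nat_numeral)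
  finally have "p ^ 3 * p \<le> K * \<nu> ^ 6 * p"
    by (simp add: eval_nat_numeral mult_ac)
  then have "p ^ 3 \<le> K * \<nu> ^ 6" using p0 by simp
  \<comment> \<open>Enlarging K to K^3, possible because K \<ge> 1, makes the right side a perfect
    cube.\<close>
  also have "\<dots> \<le> K ^ 3 * \<nu> ^ 6"
    using K1 self_le_power[of K 3] by (intro mult_right_mono) (auto simp: \<nu>_def)
  also have "\<dots> = (K * \<nu>\<^sup>2) ^ 3" by (simp add: power_mult_distrib flip: power_mult)
  finally have "p \<le> K * \<nu>\<^sup>2"
    using p0 K1 by (subst (asm) power_mono_iff) auto
  then show ?thesis by (simp add: p_def K_def \<nu>_def)
qed

subsection \<open>Stability\<close>

lemma psum_cind:
  assumes "A \<subseteq> perms" "i \<in> D" "j \<in> D"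
  shows "psum (cind A) i j = card {\<sigma> \<in> A. \<sigma> i = j} - real (card A) / fact (card D) * fact (card D - 1)"
proof -
  have fA: "finite A" using assms(1) by (rule finite_subset) simp
  have "psum (cind A) i j = (\<Sum>\<sigma>\<in>perms. cind A \<sigma> * (if \<sigma> i = j then 1 else 0))"
    unfolding psum_eq_if by (intro sum.cong refl) simp
  also have "\<dots> = (\<Sum>\<sigma>\<in>A. if \<sigma> i = j then 1 else 0)
      - real (card A) / fact (card D) * (\<Sum>\<sigma>\<in>perms. if \<sigma> i = j then 1 else 0)"
    by (rule sum_cind_mult[OF assms(1)])
  finally show ?thesis
    using fA card_perms_point[OF assms(2,3)] by (simp add: sum.If_cases Int_def)
qed

lemma sum_psum:
  assumes "i \<in> D"
  shows "(\<Sum>j\<in>D. psum f i j) = (\<Sum>\<sigma>\<in>perms. f \<sigma>)"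
  unfolding psum_def by (rule sum.group) (use assms perms_in_D in auto)

lemma sum_mult_point_sum:
  fixes h :: "'a \<Rightarrow> 'a \<Rightarrow> real"
  shows "(\<Sum>\<sigma>\<in>perms. f \<sigma> * (\<Sum>i\<in>D. h i (\<sigma> i))) = (\<Sum>i\<in>D. \<Sum>j\<in>D. h i j * psum f i j)"
proof -
  have "(\<Sum>\<sigma>\<in>perms. f \<sigma> * (\<Sum>i\<in>D. h i (\<sigma> i))) = (\<Sum>i\<in>D. \<Sum>\<sigma>\<in>perms. f \<sigma> * h i (\<sigma> i))"
    unfolding sum_distrib_left by (rule sum.swap)
  also have "\<dots> = (\<Sum>i\<in>D. \<Sum>j\<in>D. h i j * psum f i j)"
  proof (rule sum.cong[OF refl])
    fix i assume i: "i \<in> D"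
    have "(\<Sum>\<sigma>\<in>perms. f \<sigma> * h i (\<sigma> i)) = (\<Sum>j\<in>D. \<Sum>\<sigma>\<in>{\<sigma> \<in> perms. \<sigma> i = j}. f \<sigma> * h i (\<sigma> i))"
      by (rule sum.group[symmetric]) (use i perms_in_D in auto)
    also have "\<dots> = (\<Sum>j\<in>D. h i j * psum f i j)"
      unfolding psum_def sum_distrib_left by (intro sum.cong refl) auto
    finally show "(\<Sum>\<sigma>\<in>perms. f \<sigma> * h i (\<sigma> i)) = (\<Sum>j\<in>D. h i j * psum f i j)" .
  qed
  finally show ?thesis .
qed

text \<open>In \<open>cross_total_energy\<close> the energy of A is replaced by its upper bound and
  three of the four factors |A| |B| by the lower bound; what remains bounds the total energy of B
  from below. The bound on n makes its summand of order 1/n at most half of that.\<close>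

lemma cross_energy_ge:
  assumes A: "A \<subseteq> perms" and B: "B \<subseteq> perms" and AB: "cross A B" and n: "12 \<le> card D"
    and c: "0 < c" and large: "c * (fact (card D - 1))\<^sup>2 \<le> real (card A) * real (card B)"
    and N: "1 / energy_ratio c \<le> card D"
  shows "energy_ratio c * (fact (card D - 1) * real (card B)) \<le> energy (cind B)"
proof -
  define a where "a = real (card A)"
  define b where "b = real (card B)"
  define \<nu> where "\<nu> = (fact (card D - 1) :: real)"
  define \<eta> where "\<eta> = energy_ratio c"
  define K where "K = cross_const * energy_const"
  have \<nu>0: "0 < \<nu>" by (simp add: \<nu>_def)
  have \<eta>0: "0 < \<eta>" unfolding \<eta>_def by (rule energy_ratio_pos[OF c])
  have K0: "0 < K" using cross_const_ge_1 energy_const_ge_1 by (simp add: K_def)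
  have "0 < c * \<nu>\<^sup>2" using c \<nu>0 by simp
  then have "0 < a * b" using large by (simp add: a_def b_def \<nu>_def)
  then have ab: "0 < a" "0 < b" by (auto simp: a_def b_def zero_less_mult_iff)
  have "(c * \<nu>\<^sup>2) ^ 3 * (a * b) \<le> (a * b) ^ 3 * (a * b)"
    using large c ab unfolding a_def b_def \<nu>_def by (intro mult_right_mono power_mono) auto
  also have "\<dots> = (a * b) ^ 4" by (simp add: eval_nat_numeral)
  also have "\<dots> \<le> cross_const * \<nu> ^ 4 * (total_energy A * total_energy B)"
    unfolding a_def b_def \<nu>_def by (rule cross_total_energy[OF A B AB n])
  also have "\<dots> \<le> cross_const * \<nu> ^ 4 * (energy_const * (\<nu> * a) * total_energy B)"
    using total_energy_le[OF A n] total_energy_nonneg[of B] cross_const_ge_1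
    by (intro mult_left_mono mult_right_mono) (auto simp: \<nu>_def a_def)
  finally have "(\<nu> ^ 5 * a) * (c ^ 3 * (\<nu> * b)) \<le> (\<nu> ^ 5 * a) * (K * total_energy B)"
    by (simp add: K_def eval_nat_numeral mult_ac)
  then have "c ^ 3 * (\<nu> * b) \<le> K * total_energy B"
    by (rule mult_left_le_imp_le) (use \<nu>0 ab in simp)
  moreover have "c ^ 3 = K * (2 * \<eta>)"
    using cross_const_ge_1 energy_const_ge_1 by (simp add: K_def \<eta>_def energy_ratio_def)
  ultimately have "K * (2 * \<eta> * (\<nu> * b)) \<le> K * total_energy B" by (simp add: mult_ac)
  then have 1: "2 * \<eta> * (\<nu> * b) \<le> total_energy B"
    by (rule mult_left_le_imp_le) (rule K0)
  have n0: "0 < real (card D)" "D \<noteq> {}" using n by auto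
  have "1 / real (card D) \<le> \<eta>"
    using N \<eta>0 n0 unfolding \<eta>_def[symmetric] by (simp add: field_simps)
  then have "1 / real (card D) * (\<nu> * b) \<le> \<eta> * (\<nu> * b)"
    using \<nu>0 ab by (intro mult_right_mono) auto
  then show ?thesis using 1 unfolding total_energy_def \<nu>_def[symmetric] b_def[symmetric] \<eta>_def[symmetric]
    by simp
qed

text \<open>Let y be the centred star densities of B and G the statistic they define. By
  \<open>cross_energy_ge\<close> the average of G over B is at least \<eta>. If every star were
  sparse, y would be bounded by \<delta>, and \<open>sum_fourth_power_le\<close> would make the
  fourth moment of G too small for that.\<close>

lemma dense_star:
  assumes A: "A \<subseteq> perms" and B: "B \<subseteq> perms" and AB: "cross A B" and n: "12 \<le> card D"
    and c: "0 < c" and large: "c * (fact (card D - 1))\<^sup>2 \<le> real (card A) * real (card B)"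
    and le: "card B \<le> card A" and N: "1 / energy_ratio c \<le> card D"
    "2304 * (sieve_const 3)\<^sup>2 * card_const / energy_ratio c ^ 4 \<le> card D"
    "card_const / star_density c \<le> card D"
  shows "\<exists>i\<in>D. \<exists>j\<in>D. star_density c * fact (card D - 1) \<le> card {\<sigma> \<in> B. \<sigma> i = j}"
proof (rule ccontr)
  assume contra: "\<not> ?thesis"
  define b where "b = real (card B)"
  define \<nu> where "\<nu> = (fact (card D - 1) :: real)"
  define \<eta> where "\<eta> = energy_ratio c"
  define \<delta> where "\<delta> = star_density c"
  define C where "C = sieve_const 3"
  define C0 where "C0 = card_const"
  define y where "y = (\<lambda>i j. psum (cind B) i j / \<nu>)"
  define G where "G = (\<lambda>\<sigma>. \<Sum>i\<in>D. y i (\<sigma> i))"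
  define Y where "Y = (\<Sum>i\<in>D. \<Sum>j\<in>D. (y i j)\<^sup>2)"
  have \<nu>0: "0 < \<nu>" by (simp add: \<nu>_def)
  have \<eta>0: "0 < \<eta>" unfolding \<eta>_def by (rule energy_ratio_pos[OF c])
  have \<delta>0: "0 < \<delta>" unfolding \<delta>_def by (rule star_density_pos[OF c])
  have C1: "1 \<le> C" unfolding C_def by (rule sieve_const_ge_1)
  have C01: "1 \<le> C0" unfolding C0_def by (rule card_const_ge_1)
  have n0: "0 < real (card D)" "D \<noteq> {}" using n by auto
  have "0 < c * \<nu>\<^sup>2" using c \<nu>0 by simp
  then have "0 < real (card A) * b" using large by (simp add: b_def \<nu>_def)
  then have b0: "0 < b" by (auto simp: b_def zero_less_mult_iff)
  \<comment> \<open>B is the smaller family, so the bound on the product makes |B| itself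
    O((n-1)!).\<close>
  have "b\<^sup>2 \<le> real (card A) * b" using le by (simp add: b_def power2_eq_square mult_right_mono)
  also have "\<dots> \<le> C0 * \<nu>\<^sup>2"
    using cross_card_le[OF A B AB n] by (simp add: b_def C0_def card_const_def \<nu>_def)
  also have "\<dots> \<le> C0\<^sup>2 * \<nu>\<^sup>2" using C01 self_le_power[of C0 2] by (intro mult_right_mono) auto
  finally have "b\<^sup>2 \<le> (C0 * \<nu>)\<^sup>2" by (simp add: power_mult_distrib)
  then have bC: "b \<le> C0 * \<nu>" using C01 \<nu>0 by (simp add: power2_le_iff_abs_le abs_of_nonneg)
  \<comment> \<open>The average star density |B|/n! is O(1/n), hence below \<delta> for large n;
    each y i j is then a difference of two numbers in [0, \<delta>].\<close>
  have small: "b / fact (card D) \<le> \<delta>"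
  proof -
    have "fact (card D) = real (card D) * \<nu>" unfolding \<nu>_def using n by (intro fact_reduce) simp
    then have "b / fact (card D) \<le> C0 / card D"
      using bC \<nu>0 n0 by (simp add: field_simps)
    also have "\<dots> \<le> \<delta>" using N(3) \<delta>0 n0 unfolding C0_def[symmetric] \<delta>_def[symmetric] by (simp add: field_simps)
    finally show ?thesis .
  qed
  have M: "\<bar>y i j\<bar> \<le> \<delta>" if ij: "i \<in> D" "j \<in> D" for i j
  proof -
    have "real (card {\<sigma> \<in> B. \<sigma> i = j}) < \<delta> * \<nu>"
      using contra ij by (auto simp: \<delta>_def \<nu>_def not_le)
    then have "real (card {\<sigma> \<in> B. \<sigma> i = j}) / \<nu> \<le> \<delta>" using \<nu>0 by (simp add: field_simps)
    moreover have "y i j = real (card {\<sigma> \<in> B. \<sigma> i = j}) / \<nu> - b / fact (card D)"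
      unfolding y_def psum_cind[OF B ij] \<nu>_def b_def by (simp add: diff_divide_distrib)
    moreover have "0 \<le> real (card {\<sigma> \<in> B. \<sigma> i = j}) / \<nu>" "0 \<le> b / fact (card D)"
      using \<nu>0 b0 by auto
    ultimately show ?thesis using small \<delta>0 unfolding abs_le_iff by linarith
  qed
  have rows: "(\<Sum>j\<in>D. y i j) = 0" if "i \<in> D" for i
    using sum_psum[OF that, of "cind B"] sum_cind[OF B] by (simp add: y_def flip: sum_divide_distrib)
  have Ye: "Y = energy (cind B) / \<nu>\<^sup>2"
    by (simp add: Y_def y_def energy_def power_divide sum_divide_distrib)
  have "Y \<le> 2 * C * (\<nu> * b) / \<nu>\<^sup>2"
    unfolding Ye using energy_cind_le[OF B n] by (intro divide_right_mono) (auto simp: C_def \<nu>_def b_def)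
  then have YC: "Y \<le> 2 * C * b / \<nu>" using \<nu>0 by (simp add: power2_eq_square)
  have Y0: "0 \<le> Y" by (simp add: Y_def sum_nonneg)
  \<comment> \<open>G has mean zero and its coefficients are those of \<open>cind B\<close> itself,
    so summing it over B reproduces the energy divided by (n-1)!.\<close>
  have "(\<Sum>\<sigma>\<in>B. G \<sigma>) = (\<Sum>\<sigma>\<in>perms. cind B \<sigma> * G \<sigma>) + b / fact (card D) * (\<Sum>\<sigma>\<in>perms. 1 * G \<sigma>)"
    using sum_cind_mult[OF B, of G] by (simp add: b_def)
  also have "(\<Sum>\<sigma>\<in>perms. 1 * G \<sigma>) = 0"
  proof -
    have "(\<Sum>\<sigma>\<in>perms. 1 * G \<sigma>) = (\<Sum>i\<in>D. \<Sum>\<sigma>\<in>perms. y i (\<sigma> i))"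
      unfolding G_def by (subst sum.swap) simp
    also have "\<dots> = (\<Sum>i\<in>D. fact (card D - 1) * (\<Sum>j\<in>D. y i j))"
      by (intro sum.cong refl sum_perms_point)
    finally show ?thesis using rows by simp
  qed
  also have "(\<Sum>\<sigma>\<in>perms. cind B \<sigma> * G \<sigma>) = energy (cind B) / \<nu>"
    unfolding G_def sum_mult_point_sum
    by (simp add: y_def energy_def power2_eq_square sum_divide_distrib)
  finally have sG: "(\<Sum>\<sigma>\<in>B. G \<sigma>) = energy (cind B) / \<nu>" by simp
  have "\<eta> * (\<nu> * b) \<le> energy (cind B)"
    unfolding \<eta>_def \<nu>_def b_def by (rule cross_energy_ge[OF A B AB n c large N(1)])
  then have "\<eta> * b \<le> (\<Sum>\<sigma>\<in>B. G \<sigma>)" unfolding sG using \<nu>0 by (simp add: field_simps)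
  \<comment> \<open>Cauchy--Schwarz twice on B, followed by extending the sum of fourth powers to
    all permutations.\<close>
  then have "(\<eta> * b) ^ 4 \<le> (\<Sum>\<sigma>\<in>B. G \<sigma>) ^ 4" using \<eta>0 b0 by (intro power_mono) auto
  also have "\<dots> = ((\<Sum>\<sigma>\<in>B. G \<sigma>)\<^sup>2)\<^sup>2" by (simp flip: power_mult)
  also have "\<dots> \<le> (b * (\<Sum>\<sigma>\<in>B. (G \<sigma>)\<^sup>2))\<^sup>2"
    unfolding b_def by (intro power_mono square_sum_le_card) auto
  also have "\<dots> = b\<^sup>2 * (\<Sum>\<sigma>\<in>B. (G \<sigma>)\<^sup>2)\<^sup>2" by (rule power_mult_distrib)
  also have "\<dots> \<le> b\<^sup>2 * (b * (\<Sum>\<sigma>\<in>B. G \<sigma> ^ 4))"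
    using square_sum_le_card[of "\<lambda>\<sigma>. (G \<sigma>)\<^sup>2" B] unfolding b_def
    by (intro mult_left_mono) (auto simp flip: power_mult)
  also have "\<dots> \<le> b\<^sup>2 * (b * (\<Sum>\<sigma>\<in>perms. G \<sigma> ^ 4))"
    using b0 B by (intro mult_left_mono sum_mono2) auto
  also have "\<dots> \<le> b\<^sup>2 * (b * (72 * (\<nu> * \<delta>\<^sup>2 * Y + 2 * fact (card D - 2) * Y\<^sup>2)))"
    using sum_fourth_power_le[OF rows M] n b0 unfolding G_def Y_def \<nu>_def
    by (intro mult_left_mono) auto
  also have "\<dots> \<le> b\<^sup>2 * (b * (72 * (\<nu> * \<delta>\<^sup>2 * (2 * C * b / \<nu>) + 2 * (2 * \<nu> / card D) * (2 * C * b / \<nu>)\<^sup>2)))"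
    using YC Y0 b0 \<nu>0 fact_diff_two_le[of "card D"] n unfolding \<nu>_def[symmetric]
    by (intro mult_left_mono add_mono mult_mono power_mono) auto
  also have "\<dots> = b ^ 4 * (144 * C * \<delta>\<^sup>2 + 1152 * C\<^sup>2 * (b / \<nu>) / card D)"
    using \<nu>0 by (simp add: power2_eq_square power4_eq_xxxx field_simps)
  also have "\<dots> \<le> b ^ 4 * (144 * C * \<delta>\<^sup>2 + 1152 * C\<^sup>2 * C0 / card D)"
    using bC \<nu>0 b0 n0 C1 by (intro mult_left_mono add_left_mono divide_right_mono) (auto simp: field_simps)
  finally have "b ^ 4 * \<eta> ^ 4 \<le> b ^ 4 * (144 * C * \<delta>\<^sup>2 + 1152 * C\<^sup>2 * C0 / card D)"
    by (simp add: power_mult_distrib mult_ac)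
  then have main: "\<eta> ^ 4 \<le> 144 * C * \<delta>\<^sup>2 + 1152 * C\<^sup>2 * C0 / card D"
    by (rule mult_left_le_imp_le) (use b0 in simp)
  \<comment> \<open>The choice of \<delta> keeps the first term within 144/400 of \<eta>^4 and the
    second lower bound on n keeps the other within a half, which together is less than
    \<eta>^4.\<close>
  have "144 * C * \<delta>\<^sup>2 = 144 / 400 * \<eta> ^ 4 / C"
    using C1 unfolding \<delta>_def star_density_def C_def[symmetric] \<eta>_def[symmetric]
    by (simp add: power2_eq_square power4_eq_xxxx field_simps)
  also have "\<dots> \<le> 144 / 400 * \<eta> ^ 4"
    using C1 \<eta>0 by (simp add: field_simps)
  finally have p1: "144 * C * \<delta>\<^sup>2 \<le> 144 / 400 * \<eta> ^ 4" .
  have "2304 * C\<^sup>2 * C0 / \<eta> ^ 4 \<le> card D" using N(2) by (simp add: C_def C0_def \<eta>_def)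
  then have "1152 * C\<^sup>2 * C0 / card D \<le> \<eta> ^ 4 / 2"
    using \<eta>0 n0 by (simp add: field_simps)
  moreover have "0 < \<eta> ^ 4" using \<eta>0 by simp
  ultimately show False using main p1 by linarith
qed

text \<open>For k \<noteq> j the part of A sending i to k and the part of B sending i to j cannot
  agree at i. Relabelling values makes both fix i, so \<open>cross_card_le\<close> on n - 1 points
  bounds the product of their sizes by O((n-2)!^2). Dividing by the size of the dense star and
  summing over the n - 1 values k gives the claim.\<close>

lemma outside_star_le:
  fixes d :: real
  assumes A: "A \<subseteq> perms" and B: "B \<subseteq> perms" and AB: "cross A B" and n: "13 \<le> card D"
    and ij: "i \<in> D" "j \<in> D" and d: "0 < d" "d * fact (card D - 1) \<le> card {\<tau> \<in> B. \<tau> i = j}"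
  shows "card {\<sigma> \<in> A. \<sigma> i \<noteq> j} \<le> card_const / d * fact (card D - 2)"
proof -
  \<comment> \<open>The general bound is needed on the smaller ground set, which is why the locale
    leaves it arbitrary and why 13 replaces 12 here.\<close>
  interpret R: finite_ground "D - {i}" by unfold_locales simp
  define F where "F = (fact (card D - 2) :: real)"
  have cR: "card (D - {i}) = card D - 1" using ij by simp
  have fA: "finite A" using A by (rule finite_subset) simp
  have restrict: "p \<circ> \<sigma> \<in> R.perms" if "\<sigma> \<in> perms" "p permutes D" "p (\<sigma> i) = i" for p \<sigma>
  proof -
    have "p \<circ> \<sigma> permutes D" using that by (simp add: perms_def permutes_compose)
    then have "p \<circ> \<sigma> permutes D - {i}"
      by (rule permutes_superset) (use that in auto)
    then show ?thesis by (simp add: R.perms_def)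
  qed
  define B' where "B' = (\<lambda>\<tau>. transpose i j \<circ> \<tau>) ` {\<tau> \<in> B. \<tau> i = j}"
  have inj: "inj_on (\<lambda>\<sigma>. p \<circ> \<sigma>) X" if "p permutes D" for p :: "'a \<Rightarrow> 'a" and X :: "('a \<Rightarrow> 'a) set"
  proof (rule inj_onI)
    fix x y assume "p \<circ> x = p \<circ> y"
    then have "inv p \<circ> (p \<circ> x) = inv p \<circ> (p \<circ> y)" by simp
    then show "x = y" using permutes_inv_o(2)[OF that] by (simp add: o_assoc)
  qed
  have tij: "transpose i j permutes D" using ij by (rule permutes_swap_id)
  have cB': "card B' = card {\<tau> \<in> B. \<tau> i = j}" unfolding B'_def by (rule card_image[OF inj[OF tij]])
  have B'R: "B' \<subseteq> R.perms" unfolding B'_def using B tij by (auto intro!: restrict)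
  have part: "real (card {\<sigma> \<in> A. \<sigma> i = k}) \<le> card_const / d * F / real (card D - 1)"
    if k: "k \<in> D - {j}" for k
  proof -
    \<comment> \<open>\<open>p\<close> sends k to i and acts as \<open>transpose i j\<close> on all
      values other than j and k. By injectivity a common value at a position other than i is neither
      j nor k, so agreements survive the relabelling.\<close>
    define p where "p = transpose i j \<circ> transpose j k"
    define A' where "A' = (\<lambda>\<sigma>. p \<circ> \<sigma>) ` {\<sigma> \<in> A. \<sigma> i = k}"
    have tp: "p permutes D" unfolding p_def using ij k by (intro permutes_compose permutes_swap_id) auto
    have cA': "card A' = card {\<sigma> \<in> A. \<sigma> i = k}" unfolding A'_def by (rule card_image[OF inj[OF tp]])
    have "A' \<subseteq> R.perms" unfolding A'_def using A tp by (auto intro!: restrict simp: p_def)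
    moreover have "R.cross A' B'"
      unfolding R.cross_def
    proof (intro ballI)
      fix \<sigma>' \<tau>' assume "\<sigma>' \<in> A'" "\<tau>' \<in> B'"
      then obtain \<sigma> \<tau> where s: "\<sigma> \<in> A" "\<sigma> i = k" "\<sigma>' = p \<circ> \<sigma>"
        and t: "\<tau> \<in> B" "\<tau> i = j" "\<tau>' = transpose i j \<circ> \<tau>"
        by (auto simp: A'_def B'_def)
      obtain x where x: "x \<in> D" "\<sigma> x = \<tau> x" using AB s t by (auto simp: cross_def)
      have xi: "x \<noteq> i" using x s t k by auto
      have "\<sigma> x \<noteq> k" using perms_eq_iff[of \<sigma> x i] A s xi by auto
      moreover have "\<tau> x \<noteq> j" using perms_eq_iff[of \<tau> x i] B t xi by auto
      ultimately have "\<sigma>' x = \<tau>' x" using x s t by (simp add: p_def)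
      then show "\<exists>x\<in>D - {i}. \<sigma>' x = \<tau>' x" using x xi by auto
    qed
    ultimately have "real (card A') * real (card B') \<le> card_const * (fact (card (D - {i}) - 1))\<^sup>2"
      unfolding card_const_def using B'R n cR by (intro R.cross_card_le) auto
    then have "real (card A') * real (card B') \<le> card_const * F\<^sup>2"
      using cR by (simp add: F_def numeral_2_eq_2)
    moreover have "real (card A') * (d * fact (card D - 1)) \<le> real (card A') * real (card B')"
      unfolding cB' using d by (intro mult_left_mono) auto
    moreover have "fact (card D - 1) = real (card D - 1) * F"
      unfolding F_def using n fact_reduce[of "card D - 1", where 'a = real] by (simp add: numeral_2_eq_2)
    ultimately have "real (card A') * (d * real (card D - 1)) * F \<le> card_const * F * F"
      by (simp add: power2_eq_square mult_ac)
    then have le: "real (card A') * (d * real (card D - 1)) \<le> card_const * F"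
      by (rule mult_right_le_imp_le) (simp add: F_def)
    have "0 < d * real (card D - 1)" using d n by simp
    then have "real (card A') \<le> card_const * F / (d * real (card D - 1))"
      using le by (simp only: pos_le_divide_eq)
    then show ?thesis unfolding cA' by simp
  qed
  have "card {\<sigma> \<in> A. \<sigma> i \<noteq> j} = (\<Sum>k\<in>D - {j}. card {\<sigma> \<in> {\<sigma> \<in> A. \<sigma> i \<noteq> j}. \<sigma> i = k})"
  proof -
    have "(\<lambda>\<sigma>. \<sigma> i) ` {\<sigma> \<in> A. \<sigma> i \<noteq> j} \<subseteq> D - {j}" using A ij perms_in_D by auto
    from sum.group[OF _ _ this, of "\<lambda>_. 1 :: nat"] show ?thesis using fA by simp
  qed
  also have "\<dots> = (\<Sum>k\<in>D - {j}. card {\<sigma> \<in> A. \<sigma> i = k})"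
    by (intro sum.cong refl arg_cong[where f = card]) auto
  finally have "real (card {\<sigma> \<in> A. \<sigma> i \<noteq> j}) = (\<Sum>k\<in>D - {j}. real (card {\<sigma> \<in> A. \<sigma> i = k}))"
    by simp
  also have "\<dots> \<le> (\<Sum>k\<in>D - {j}. card_const / d * F / real (card D - 1))"
    by (intro sum_mono part)
  also have "\<dots> = card_const / d * F" using ij n by simp
  finally show ?thesis by (simp add: F_def)
qed

text \<open>The dense star of the smaller family B confines A. As |A| is at least of order (n-1)!,
  most of A then lies in the same star, which is therefore dense for A and in turn confines
  B.\<close>

lemma cross_stability:
  assumes A: "A \<subseteq> perms" and B: "B \<subseteq> perms" and AB: "cross A B" and n: "13 \<le> card D"
    and c: "0 < c" and large: "c * (fact (card D - 1))\<^sup>2 \<le> real (card A) * real (card B)"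
    and le: "card B \<le> card A" and N: "1 / energy_ratio c \<le> card D"
    "2304 * (sieve_const 3)\<^sup>2 * card_const / energy_ratio c ^ 4 \<le> card D"
    "card_const / star_density c \<le> card D"
    "4 * card_const\<^sup>2 / (star_density c * c) \<le> card D"
  shows "\<exists>i\<in>D. \<exists>j\<in>D. card {\<sigma> \<in> A. \<sigma> i \<noteq> j} \<le> card_const / star_density c * fact (card D - 2)
    \<and> card {\<sigma> \<in> B. \<sigma> i \<noteq> j} \<le> 2 * card_const\<^sup>2 / c * fact (card D - 2)"
proof -
  define \<nu> where "\<nu> = (fact (card D - 1) :: real)"
  define \<delta> where "\<delta> = star_density c"
  define C0 where "C0 = card_const"
  have \<nu>0: "0 < \<nu>" by (simp add: \<nu>_def)
  have \<delta>0: "0 < \<delta>" unfolding \<delta>_def by (rule star_density_pos[OF c])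
  have C01: "1 \<le> C0" unfolding C0_def by (rule card_const_ge_1)
  have n0: "0 < real (card D)" "D \<noteq> {}" using n by auto
  have n12: "12 \<le> card D" using n by simp
  obtain i j where ij: "i \<in> D" "j \<in> D" and star: "\<delta> * \<nu> \<le> card {\<sigma> \<in> B. \<sigma> i = j}"
    using dense_star[OF A B AB n12 c large le N(1-3)] unfolding \<delta>_def \<nu>_def by blast
  have Aout: "card {\<sigma> \<in> A. \<sigma> i \<noteq> j} \<le> C0 / \<delta> * fact (card D - 2)"
    unfolding C0_def by (rule outside_star_le[OF A B AB n ij \<delta>0]) (use star in \<open>simp add: \<nu>_def\<close>)
  have fA: "finite A" using A by (rule finite_subset) simp
  have "card A = card {\<sigma> \<in> A. \<sigma> i = j} + card {\<sigma> \<in> A. \<sigma> i \<noteq> j}"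
    using fA by (subst card_Un_disjoint[symmetric]) (auto intro: arg_cong[where f = card])
  then have split: "real (card A) = real (card {\<sigma> \<in> A. \<sigma> i = j}) + real (card {\<sigma> \<in> A. \<sigma> i \<noteq> j})" by simp
  have up: "real (card A) * real (card B) \<le> C0 * \<nu>\<^sup>2"
    using cross_card_le[OF A B AB n12] by (simp add: C0_def card_const_def \<nu>_def)
  have "(real (card B))\<^sup>2 \<le> real (card A) * real (card B)"
    using le by (simp add: power2_eq_square mult_right_mono)
  also have "\<dots> \<le> C0\<^sup>2 * \<nu>\<^sup>2"
    using up mult_right_mono[OF self_le_power[OF C01, of 2], of "\<nu>\<^sup>2"] by simp
  finally have "(real (card B))\<^sup>2 \<le> (C0 * \<nu>)\<^sup>2" by (simp add: power_mult_distrib)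
  then have bC: "real (card B) \<le> C0 * \<nu>" using C01 \<nu>0 by (simp add: power2_le_iff_abs_le abs_of_nonneg)
  \<comment> \<open>Since |B| \<le> C0 (n-1)!, the lower bound on the product forces |A| \<ge> c
    (n-1)!/C0.\<close>
  have "c * \<nu>\<^sup>2 \<le> real (card A) * (C0 * \<nu>)"
    using large mult_left_mono[OF bC, of "real (card A)"] unfolding \<nu>_def by linarith
  then have "(c * \<nu>) * \<nu> \<le> (real (card A) * C0) * \<nu>" by (simp add: power2_eq_square mult_ac)
  then have "c * \<nu> \<le> real (card A) * C0" by (rule mult_right_le_imp_le) (rule \<nu>0)
  then have lowA: "c * \<nu> / C0 \<le> real (card A)" using C01 by (simp add: field_simps)
  \<comment> \<open>The last lower bound on n makes the part of A outside the star at most half of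
    this lower bound for |A|, leaving density c/(2 C0) inside.\<close>
  have "C0 / \<delta> * fact (card D - 2) \<le> C0 / \<delta> * (2 * \<nu> / card D)"
    using fact_diff_two_le[of "card D"] n C01 \<delta>0 unfolding \<nu>_def by (intro mult_left_mono) auto
  also have "\<dots> \<le> c * \<nu> / (2 * C0)"
  proof -
    have "4 * C0\<^sup>2 \<le> card D * (\<delta> * c)"
      using N(4) \<delta>0 c unfolding C0_def[symmetric] \<delta>_def[symmetric] by (simp add: pos_divide_le_eq)
    then have "4 * C0\<^sup>2 * \<nu> \<le> card D * (\<delta> * c) * \<nu>" using \<nu>0 by (intro mult_right_mono) auto
    then show ?thesis using \<delta>0 c n0 C01 by (simp add: field_simps power2_eq_square)
  qed
  finally have "real (card {\<sigma> \<in> A. \<sigma> i \<noteq> j}) \<le> c * \<nu> / (2 * C0)" using Aout by linarith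
  moreover have "c * \<nu> / C0 = c * \<nu> / (2 * C0) + c * \<nu> / (2 * C0)" using C01 by (simp add: field_simps)
  ultimately have "c / (2 * C0) * \<nu> \<le> real (card {\<sigma> \<in> A. \<sigma> i = j})" using lowA split by simp
  then have "card {\<sigma> \<in> B. \<sigma> i \<noteq> j} \<le> card_const / (c / (2 * C0)) * fact (card D - 2)"
    using c C01 unfolding \<nu>_def by (intro outside_star_le[OF B A cross_sym[OF AB] n ij]) auto
  then have "card {\<sigma> \<in> B. \<sigma> i \<noteq> j} \<le> 2 * card_const\<^sup>2 / c * fact (card D - 2)"
    by (simp add: C0_def power2_eq_square mult_ac)
  then show ?thesis using ij Aout unfolding C0_def \<delta>_def by blast
qed

end

section \<open>Families on \<open>{1..n}\<close> and the choice of K\<close>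

theorem theorem8:
  fixes c :: real
  assumes "c > 0"
  shows "\<exists>K::real. K > 0 \<and>
    (\<forall>n::nat. \<forall>A B. A \<subseteq> sym_grp n \<longrightarrow> B \<subseteq> sym_grp n \<longrightarrow>
       cross_intersecting n A B \<longrightarrow>
       sqrt (real (card A) * real (card B)) \<ge> c * fact (n - 1) \<longrightarrow>
       (\<exists>i\<in>{1..n}. \<exists>j\<in>{1..n}.
          real (card {\<sigma>\<in>A. \<sigma> i \<noteq> j}) \<le> K * fact (n - 2) \<and>
          real (card {\<sigma>\<in>B. \<sigma> i \<noteq> j}) \<le> K * fact (n - 2)))"
proof -
  \<comment> \<open>Squaring the bound on the geometric mean gives the product form used in
    \<open>cross_stability\<close>.\<close>
  define c2 where "c2 = c\<^sup>2"
  have c2: "0 < c2" using assms by (simp add: c2_def)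
  \<comment> \<open>The largest of the lower bounds on n required by
    \<open>cross_stability\<close>.\<close>
  define N where "N = Max {13, 1 / energy_ratio c2, 2304 * (sieve_const 3)\<^sup>2 * card_const / energy_ratio c2 ^ 4,
    card_const / star_density c2, 4 * card_const\<^sup>2 / (star_density c2 * c2)}"
  have N: "13 \<le> N" "1 / energy_ratio c2 \<le> N"
    "2304 * (sieve_const 3)\<^sup>2 * card_const / energy_ratio c2 ^ 4 \<le> N"
    "card_const / star_density c2 \<le> N" "4 * card_const\<^sup>2 / (star_density c2 * c2) \<le> N"
    unfolding N_def by (rule Max_ge; simp)+
  define K1 where "K1 = card_const / star_density c2"
  define K2 where "K2 = 2 * card_const\<^sup>2 / c2"
  \<comment> \<open>The summand N^2 covers n < N, where n! \<le> n^2 (n-2)! makes the claim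
    trivial.\<close>
  define K where "K = K1 + K2 + N\<^sup>2"
  have K12: "0 \<le> K1" "0 \<le> K2"
    using card_const_ge_1 star_density_pos[OF c2] c2 by (auto simp: K1_def K2_def)
  have N2: "0 < N\<^sup>2" using N(1) by simp
  have K0: "0 < K" unfolding K_def using K12 N2 by linarith
  have stab: "\<exists>i\<in>{1..n}. \<exists>j\<in>{1..n}. real (card {\<sigma>\<in>A. \<sigma> i \<noteq> j}) \<le> K * fact (n - 2) \<and>
          real (card {\<sigma>\<in>B. \<sigma> i \<noteq> j}) \<le> K * fact (n - 2)"
    if A: "A \<subseteq> sym_grp n" and B: "B \<subseteq> sym_grp n" and AB: "cross_intersecting n A B"
      and s: "c * fact (n - 1) \<le> sqrt (real (card A) * real (card B))" and le: "card B \<le> card A" for n A B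
  proof -
    interpret finite_ground "{1..n}" by unfold_locales simp
    have perms: "perms = sym_grp n" unfolding perms_def sym_grp_def ..
    have cn: "card {1..n} = n" by simp
    have "(c * fact (n - 1))\<^sup>2 \<le> (sqrt (real (card A) * real (card B)))\<^sup>2"
      using s assms by (intro power_mono) auto
    then have large: "c2 * (fact (n - 1))\<^sup>2 \<le> real (card A) * real (card B)"
      by (simp add: c2_def power_mult_distrib)
    have cr: "cross A B" using AB unfolding cross_def cross_intersecting_def .
    show ?thesis
    proof (cases "N \<le> real n")
      case True
      have "\<exists>i\<in>{1..n}. \<exists>j\<in>{1..n}. card {\<sigma> \<in> A. \<sigma> i \<noteq> j} \<le> K1 * fact (n - 2)
          \<and> card {\<sigma> \<in> B. \<sigma> i \<noteq> j} \<le> K2 * fact (n - 2)"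
        unfolding K1_def K2_def
      proof (rule cross_stability[unfolded perms cn])
        show "13 \<le> n" using N(1) True by simp
      qed (use A B cr c2 large le N True in auto)
      moreover have "K1 * fact (n - 2) \<le> K * fact (n - 2)" "K2 * fact (n - 2) \<le> K * fact (n - 2)"
        using K12 N2 by (auto simp: K_def intro!: mult_right_mono)
      ultimately show ?thesis by (meson order_trans)
    next
      case False
      \<comment> \<open>Both families are nonempty, so a position of agreement exists; this excludes
        n = 0.\<close>
      have "0 < c2 * (fact (n - 1))\<^sup>2" using c2 by simp
      then have "A \<noteq> {}" "B \<noteq> {}" using large by auto
      then obtain \<sigma> \<tau> where "\<sigma> \<in> A" "\<tau> \<in> B" by blast
      then obtain i where "i \<in> {1..n}" using cr unfolding cross_def by blast
      then have n1: "1 \<le> n" by simp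
      have "real n * real n \<le> N\<^sup>2"
        using False unfolding power2_eq_square by (intro mult_mono) auto
      moreover have "fact n \<le> real n * real n * fact (n - 2)"
      \<comment> \<open>At n = 1 truncated subtraction gives (n-2)! = 0! = 1, and the inequality
        reads 1 \<le> 1.\<close>
      proof (cases "n = 1")
        case False
        then have "fact n = real n * (real (n - 1) * fact (n - 2))"
          using n1 fact_reduce[of n, where 'a = real] fact_reduce[of "n - 1", where 'a = real]
          by (simp add: numeral_2_eq_2)
        also have "\<dots> \<le> real n * (real n * fact (n - 2))"
          by (intro mult_left_mono mult_right_mono) auto
        finally show ?thesis by simp
      qed simp
      ultimately have "fact n \<le> N\<^sup>2 * fact (n - 2)"
        by (meson fact_ge_zero mult_right_mono order_trans)
      also have "\<dots> \<le> K * fact (n - 2)" using K12 by (intro mult_right_mono) (auto simp: K_def)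
      finally have "real (fact n) \<le> K * fact (n - 2)" by simp
      moreover have "card {\<sigma> \<in> X. \<sigma> i \<noteq> j} \<le> fact n" if "X \<subseteq> sym_grp n" for X i j
        using card_mono[OF finite_perms, of "{\<sigma> \<in> X. \<sigma> i \<noteq> j}"] that
        unfolding card_perms unfolding perms cn by auto
      ultimately have "real (card {\<sigma> \<in> X. \<sigma> i \<noteq> j}) \<le> K * fact (n - 2)" if "X \<subseteq> sym_grp n" for X i j
        using that by (meson of_nat_mono order_trans)
      then show ?thesis using A B n1 by (intro bexI[of _ 1]) auto
    qed
  qed
  \<comment> \<open>The conclusion is symmetric in the two families, so ordering them by size loses
    nothing.\<close>
  have "\<exists>i\<in>{1..n}. \<exists>j\<in>{1..n}. real (card {\<sigma>\<in>A. \<sigma> i \<noteq> j}) \<le> K * fact (n - 2) \<and>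
          real (card {\<sigma>\<in>B. \<sigma> i \<noteq> j}) \<le> K * fact (n - 2)"
    if A: "A \<subseteq> sym_grp n" and B: "B \<subseteq> sym_grp n" and AB: "cross_intersecting n A B"
      and s: "c * fact (n - 1) \<le> sqrt (real (card A) * real (card B))" for n A B
  proof (cases "card B \<le> card A")
    case True
    then show ?thesis using stab[OF A B AB s] by blast
  next
    case False
    have "cross_intersecting n B A" using AB unfolding cross_intersecting_def by metis
    moreover have "c * fact (n - 1) \<le> sqrt (real (card B) * real (card A))" using s by (simp add: mult.commute)
    ultimately show ?thesis using stab[OF B A] False by fastforce
  qed
  then show ?thesis using K0 by blast
qed

end
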